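(* Let $P_1,\dots,P_k \subseteq \mathbb{R}^p$ be pairwise disjoint $0/1$-polytopes. Then \[ \operatorname{xc}^*\Big(\operatorname{conv}\big(\textstyle\bigcup_{i=1}^k P_i\big)\Big) \leq \sum_{i=1}^k \operatorname{xc}^*(P_i) + \big|\{ i : \dim(P_i) = 0\}\big|. \]
   Context: A $0/1$-polytope is a polytope all of whose vertices lie in $\{0,1\}^p$. For a polytope $P \subseteq \mathbb{R}^p$, an extension of $P$ is a pair $(Q,\pi)$ where $Q \subseteq \mathbb{R}^q$ is a polyhedron and $\pi\colon \mathbb{R}^q \to \mathbb{R}^p$ is a linear map with $\pi(Q)=P$; its size is the number of facets of $Q$. An extension $(Q,\pi)$ of a $0/1$-polytope $P$ is a nice $0/1$-extension if (i) $Q$ is a $0/1$-polytope, (ii) each vertex of $Q$ is mapped by $\pi$ onto a vertex of $P$, and (iii) for each vertex $v$ of $P$ there is exactly one vertex of $Q$ mapped onto $v$. $\operatorname{xc}^*(P)$ is the smallest size of any nice $0/1$-extension of $P$. *)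

theory Defs
  imports "HOL-Analysis.Analysis" "HOL-Analysis.Finite_Function_Topology"
begin

text \<open>
  The dimension of the space containing an extension is not bounded in advance, so all the spaces
  \<open>\<real>\<^sup>n\<close> are taken inside the one real vector space of finitely supported sequences:
  \<open>\<real>\<^sup>n\<close> consists of the sequences that vanish from index \<open>n\<close> on, and the coordinates
  are numbered from \<open>0\<close> to \<open>n - 1\<close>.
\<close>

type_synonym rvec = "nat \<Rightarrow>\<^sub>0 real"

definition rspace :: "nat \<Rightarrow> rvec set" where
  "rspace n = {x. Poly_Mapping.keys x \<subseteq> {..<n}}"

text \<open>
  The library defines \<^const>\<open>aff_dim\<close> and \<^const>\<open>facet_of\<close> on Euclidean spaces only.
  The next two definitions have the same right-hand sides over an arbitrary real vector space;
  they are used only for sets of finite dimension, and the empty set has dimension \<open>-1\<close>.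
\<close>

definition affine_dim :: "'a::real_vector set \<Rightarrow> int" where
  "affine_dim V = (SOME d :: int.
     \<exists>B. affine hull B = affine hull V \<and> \<not> affine_dependent B \<and> of_nat (card B) = d + 1)"

definition is_facet :: "'a::real_vector set \<Rightarrow> 'a set \<Rightarrow> bool" where
  "is_facet F S \<longleftrightarrow> F face_of S \<and> F \<noteq> {} \<and> affine_dim F = affine_dim S - 1"

lemma affine_dim_eq_aff_dim: "affine_dim V = aff_dim V"
  by (simp add: affine_dim_def aff_dim_def)

lemma is_facet_iff_facet_of: "is_facet F S \<longleftrightarrow> F facet_of S"
  by (simp add: is_facet_def facet_of_def affine_dim_eq_aff_dim)

text \<open>
  The solution set in \<open>\<real>\<^sup>q\<close> of finitely many linear inequalities \<open>A x \<le> b\<close>; zero rows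
  are allowed, so that the empty set is a polyhedron for \<open>q = 0\<close> too.
\<close>

definition is_polyhedron :: "nat \<Rightarrow> rvec set \<Rightarrow> bool" where
  "is_polyhedron q Q \<longleftrightarrow>
     (\<exists>(m::nat) (A::nat \<Rightarrow> nat \<Rightarrow> real) (b::nat \<Rightarrow> real).
        Q = {x \<in> rspace q. \<forall>i<m. (\<Sum>j<q. A i j * Poly_Mapping.lookup x j) \<le> b i})"

definition zero_one_polytope :: "nat \<Rightarrow> rvec set \<Rightarrow> bool" where
  "zero_one_polytope p P \<longleftrightarrow>
     P \<subseteq> rspace p \<and> polytope P \<and>
     (\<forall>v. v extreme_point_of P \<longrightarrow> (\<forall>i<p. Poly_Mapping.lookup v i \<in> {0, 1}))"

text \<open>
  A linear map from \<open>\<real>\<^sup>q\<close> to \<open>\<real>\<^sup>p\<close> is represented by a linear extension of it to all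
  finitely supported sequences; only its values on \<open>\<real>\<^sup>q\<close> are used.
\<close>

definition is_extension ::
    "nat \<Rightarrow> rvec set \<Rightarrow> nat \<Rightarrow> rvec set \<Rightarrow> (rvec \<Rightarrow> rvec) \<Rightarrow> bool" where
  "is_extension p P q Q \<pi> \<longleftrightarrow>
     is_polyhedron q Q \<and> linear \<pi> \<and> \<pi> ` rspace q \<subseteq> rspace p \<and> \<pi> ` Q = P"

definition extension_size :: "rvec set \<Rightarrow> nat" where
  "extension_size Q = card {F. is_facet F Q}"

definition nice_zero_one_extension ::
    "nat \<Rightarrow> rvec set \<Rightarrow> nat \<Rightarrow> rvec set \<Rightarrow> (rvec \<Rightarrow> rvec) \<Rightarrow> bool" where
  "nice_zero_one_extension p P q Q \<pi> \<longleftrightarrow>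
     is_extension p P q Q \<pi> \<and>
     zero_one_polytope q Q \<and>
     (\<forall>w. w extreme_point_of Q \<longrightarrow> \<pi> w extreme_point_of P) \<and>
     (\<forall>v. v extreme_point_of P \<longrightarrow> (\<exists>!w. w extreme_point_of Q \<and> \<pi> w = v))"

text \<open>
  The minimum exists for every 0/1-polytope \<open>P\<close>, since \<open>P\<close> with the identity map is a nice
  0/1-extension of itself.
\<close>

definition xc_star :: "nat \<Rightarrow> rvec set \<Rightarrow> nat" where
  "xc_star p P =
     (LEAST s. \<exists>q Q \<pi>. nice_zero_one_extension p P q Q \<pi> \<and> s = extension_size Q)"

end

theory Submission
  imports Defs
begin

text \<open>
  Given nice extensions \<open>Q\<close> and \<open>R\<close> of two 0/1-polytopes without a common vertex, place them in
  complementary coordinate subspaces, separated by one more 0/1-coordinate. The convex hull of the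
  two copies is a nice extension of the hull of the union. A facet of this join is the join of
  \<open>R\<close> with a facet of \<open>Q\<close>, or with the empty set if \<open>Q\<close> is a point, or conversely: dimensions
  plus one are additive under joins, so exactly one part of a facet loses a dimension. The theorem
  follows by adding the polytopes one at a time.
\<close>

section \<open>Affine dimension by homogenization\<close>

text \<open>The type \<open>rvec\<close> is infinite-dimensional, so every dimension count is
  carried out inside a finitely spanned subspace, after homogenization: \<open>x\<close> becomes
  \<open>(x, 1)\<close>, affine hulls become spans, and \<open>affine_dim\<close> plus one becomes a
  linear \<open>dim\<close>, with value 0 for the empty set. This is the shift by one under which
  dimensions of joins add. The correction term stems from the empty face. It is the face of
  codimension one of a point, but \<open>is_facet\<close> excludes it; the join with a point
  nevertheless acquires a facet from it, as a pyramid has its base opposite the apex. Niceness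
  survives because a hull of 0/1-polytopes loses no vertex: every 0/1-point is a vertex of the unit
  cube. The bounds of the cube also make the inequality description of a join exact. As
  \<open>xc_star\<close> is a \<open>LEAST\<close>, its value must be shown to be attained. The same
  join does this: it builds a nice extension of any 0/1-polytope by adding one vertex at a
  time.\<close>

abbreviation homog :: "'a::real_vector set \<Rightarrow> ('a \<times> real) set" where
  "homog S \<equiv> (\<lambda>x. (x, 1)) ` S"

text \<open>The last coordinate of a linear combination of homogenized points is the sum of its
  coefficients, so the combinations at height 1 are exactly the affine ones.\<close>

lemma mem_affine_hull_iff_homog: "x \<in> affine hull S \<longleftrightarrow> (x, 1) \<in> span (homog S)"
proof
  have "affine {x. (x, 1::real) \<in> span (homog S)}"
    unfolding affine_def
  proof (clarsimp)
    fix x y :: 'a and u v :: real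
    assume *: "(x, 1::real) \<in> span (homog S)" "(y, 1::real) \<in> span (homog S)" "u + v = 1"
    have "u *\<^sub>R (x, 1::real) + v *\<^sub>R (y, 1) \<in> span (homog S)"
      using * by (intro span_add span_scale)
    then show "(u *\<^sub>R x + v *\<^sub>R y, 1) \<in> span (homog S)"
      using * by simp
  qed
  then have "affine hull S \<subseteq> {x. (x, 1::real) \<in> span (homog S)}"
    by (intro hull_minimal) (auto intro: span_base)
  then show "x \<in> affine hull S \<Longrightarrow> (x, 1) \<in> span (homog S)" by auto
next
  assume "(x, 1) \<in> span (homog S)"
  then obtain t r where t: "finite t" "t \<subseteq> homog S" "(\<Sum>a\<in>t. r a *\<^sub>R a) = (x, 1)"
    unfolding span_explicit by auto
  obtain T where T: "T \<subseteq> S" "t = homog T"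
    using t(2) by (auto simp: subset_image_iff)
  have inj: "inj_on (\<lambda>x::'a. (x, 1::real)) T" by (auto simp: inj_on_def)
  have fin: "finite T" using t(1) T(2) inj by (simp add: finite_image_iff)
  have eq: "(\<Sum>a\<in>T. r (a, 1) *\<^sub>R (a, 1::real)) = (x, 1)"
    using t(3) T(2) inj by (simp add: sum.reindex)
  have 1: "(\<Sum>a\<in>T. r (a, 1) *\<^sub>R a) = x"
    using arg_cong[OF eq, of fst] by (simp add: fst_sum)
  have 2: "(\<Sum>a\<in>T. r (a, 1)) = 1"
    using arg_cong[OF eq, of snd] by (simp add: snd_sum)
  then have "T \<noteq> {}" by auto
  then show "x \<in> affine hull S"
    unfolding affine_hull_explicit using fin T(1) 1 2 by blast
qed

lemma affine_dependent_iff_homog: "affine_dependent S \<longleftrightarrow> dependent (homog S)"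
proof -
  have "homog S - {(x, 1)} = homog (S - {x})" for x :: 'a by auto
  then show ?thesis
    by (auto simp: affine_dependent_def dependent_def mem_affine_hull_iff_homog)
qed

lemma affine_hull_eq_iff_homog:
  "affine hull S = affine hull T \<longleftrightarrow> span (homog S) = span (homog T)"
proof
  assume *: "affine hull S = affine hull T"
  have "homog S \<subseteq> span (homog T)"
    using * hull_subset[of S affine] by (auto simp flip: mem_affine_hull_iff_homog)
  moreover have "homog T \<subseteq> span (homog S)"
    using * hull_subset[of T affine] by (auto simp flip: mem_affine_hull_iff_homog)
  ultimately show "span (homog S) = span (homog T)" by (simp add: span_eq)
next
  assume "span (homog S) = span (homog T)"
  then show "affine hull S = affine hull T"
    by (auto simp: mem_affine_hull_iff_homog)
qed

text \<open>A basis of \<open>homog V\<close> chosen inside \<open>homog V\<close> is the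
  homogenization of an affinely independent subset of \<open>V\<close>; conversely, every admissible
  \<open>B\<close> in the \<open>SOME\<close> homogenizes to a basis of the same span. So the choice
  is unique and can be computed by linear algebra.\<close>

lemma affine_dim_eq_dim: "affine_dim V = int (dim (homog V)) - 1"
  unfolding affine_dim_def
proof (rule some_equality)
  obtain C where C: "C \<subseteq> homog V" "independent C" "homog V \<subseteq> span C" "card C = dim (homog V)"
    by (rule basis_exists)
  obtain B where B: "B \<subseteq> V" "C = homog B"
    using C(1) by (auto simp: subset_image_iff)
  have "span (homog B) = span (homog V)"
    using C(1,3) B(2) span_mono[of C "homog V"] span_minimal[of "homog V" "span C"] by auto
  moreover have "card B = dim (homog V)"
    using B C(4) card_image[of "\<lambda>x. (x, 1::real)" B] by (auto simp: inj_on_def)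
  ultimately show "\<exists>B. affine hull B = affine hull V \<and> \<not> affine_dependent B \<and>
      of_nat (card B) = int (dim (homog V)) - 1 + 1"
    using B C by (auto simp: affine_hull_eq_iff_homog affine_dependent_iff_homog intro!: exI[of _ B])
next
  fix d :: int assume "\<exists>B. affine hull B = affine hull V \<and> \<not> affine_dependent B \<and> of_nat (card B) = d + 1"
  then obtain B where B: "span (homog B) = span (homog V)" "independent (homog B)"
      "of_nat (card B) = d + 1"
    by (auto simp: affine_hull_eq_iff_homog affine_dependent_iff_homog)
  have "dim (homog V) = card (homog B)"
    using B(1,2) by (intro dim_eq_card)
  also have "\<dots> = card B"
    by (intro card_image) (auto simp: inj_on_def)
  finally show "d = int (dim (homog V)) - 1" using B(3) by simp
qed

section \<open>Linear dimension inside a finitely spanned set\<close>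

lemma homog_subset_span:
  assumes "S \<subseteq> affine hull V" shows "homog S \<subseteq> span (homog V)"
  using assms by (auto simp flip: mem_affine_hull_iff_homog)

text \<open>A basis of \<open>A\<close> extends to one of \<open>B\<close>, and the finite set
  \<open>W\<close> makes both finite. Finiteness matters: \<open>card\<close>, and with it
  \<open>dim\<close>, is 0 on an infinite basis, which would break monotonicity. For finite bases,
  equal cardinality forces the two to coincide.\<close>

lemma dim_subset_spanned:
  fixes A B W :: "'a::real_vector set"
  assumes "A \<subseteq> B" "B \<subseteq> span W" "finite W"
  shows "dim A \<le> dim B" and "dim A = dim B \<Longrightarrow> B \<subseteq> span A"
proof -
  obtain C where C: "C \<subseteq> A" "independent C" "A \<subseteq> span C" "card C = dim A"
    by (rule basis_exists)
  obtain D where D: "C \<subseteq> D" "D \<subseteq> B" "independent D" "B \<subseteq> span D"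
    using maximal_independent_subset_extend[of C B] C assms(1) by blast
  have fin: "finite D"
    using independent_span_bound[OF assms(3) D(3)] D(2) assms(2) by auto
  have cD: "card D = dim B"
    using D dim_unique[of D B] by simp
  show "dim A \<le> dim B"
    using card_mono[OF fin D(1)] C(4) cD by simp
  assume "dim A = dim B"
  then have "C = D"
    using card_subset_eq[OF fin D(1)] C(4) cD by simp
  then show "B \<subseteq> span A"
    using D(4) span_mono[OF C(1)] by auto
qed

text \<open>In a linear relation on the union of two bases, the part over \<open>C\<close> is the
  negative of the part over \<open>D\<close>, hence lies in both spans and vanishes; each basis then
  kills its own coefficients.\<close>

lemma dim_Un_direct:
  fixes A B W :: "'a::real_vector set"
  assumes "A \<union> B \<subseteq> span W" "finite W" and direct: "span A \<inter> span B = {0}"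
  shows "dim (A \<union> B) = dim A + dim B"
proof -
  obtain C where C: "C \<subseteq> A" "independent C" "A \<subseteq> span C" "card C = dim A"
    by (rule basis_exists)
  obtain D where D: "D \<subseteq> B" "independent D" "B \<subseteq> span D" "card D = dim B"
    by (rule basis_exists)
  have fin: "finite C" "finite D"
    using independent_span_bound[OF assms(2) C(2)] independent_span_bound[OF assms(2) D(2)]
      C(1) D(1) assms(1) by auto
  have disj: "C \<inter> D = {}"
  proof -
    have "C \<inter> D \<subseteq> {0}"
      using C(1) D(1) direct span_superset[of A] span_superset[of B] by blast
    then show ?thesis using dependent_zero[of C] C(2) by auto
  qed
  have indep: "independent (C \<union> D)"
    unfolding dependent_finite[OF finite_UnI[OF fin]]
  proof clarify
    fix u v assume v: "v \<in> C \<union> D" "u v \<noteq> 0" and z: "(\<Sum>v\<in>C \<union> D. u v *\<^sub>R v) = 0"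
    have sum: "(\<Sum>v\<in>C. u v *\<^sub>R v) + (\<Sum>v\<in>D. u v *\<^sub>R v) = 0"
      using z fin disj by (simp add: sum.union_disjoint)
    have c: "(\<Sum>v\<in>C. u v *\<^sub>R v) \<in> span A"
      using C(1) by (intro span_sum span_scale span_base) auto
    have d: "(\<Sum>v\<in>D. u v *\<^sub>R v) \<in> span B"
      using D(1) by (intro span_sum span_scale span_base) auto
    have "(\<Sum>v\<in>C. u v *\<^sub>R v) = - (\<Sum>v\<in>D. u v *\<^sub>R v)"
      using sum by (simp only: eq_neg_iff_add_eq_0)
    then have "(\<Sum>v\<in>C. u v *\<^sub>R v) \<in> span B"
      using span_neg[OF d] by simp
    then have C0: "(\<Sum>v\<in>C. u v *\<^sub>R v) = 0"
      using c direct by blast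
    have D0: "(\<Sum>v\<in>D. u v *\<^sub>R v) = 0"
      using sum unfolding C0 by simp
    have "\<forall>v\<in>C. u v = 0" "\<forall>v\<in>D. u v = 0"
      using C(2) D(2) C0 D0 unfolding dependent_finite[OF fin(1)] dependent_finite[OF fin(2)]
      by blast+
    then show False using v by auto
  qed
  have "dim (A \<union> B) = card (C \<union> D)"
  proof (rule dim_unique[of "C \<union> D"])
    show "A \<union> B \<subseteq> span (C \<union> D)"
      using C(3) D(3) span_mono[of C "C \<union> D"] span_mono[of D "C \<union> D"] by auto
  qed (use C(1) D(1) indep in auto)
  then show ?thesis
    using C(4) D(4) fin disj by (simp add: card_Un_disjoint)
qed

lemma dim_injective_image:
  assumes "linear f" "inj f" shows "dim (f ` A) = dim A"
proof -
  obtain C where C: "C \<subseteq> A" "independent C" "A \<subseteq> span C" "card C = dim A"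
    by (rule basis_exists)
  have "dim (f ` A) = card (f ` C)"
  proof (rule dim_unique[of "f ` C"])
    show "f ` A \<subseteq> span (f ` C)"
      using C(3) by (simp add: linear_span_image[OF assms(1)] image_mono)
    show "independent (f ` C)"
      using assms C(2) by (intro linear_independent_injective_image) (auto intro: inj_on_subset)
  qed (use C(1) in auto)
  then show ?thesis
    using C(4) assms(2) by (simp add: card_image inj_on_subset)
qed

lemma affine_dim_affine_image:
  assumes "linear f" "inj f"
  shows "affine_dim ((\<lambda>x. a + f x) ` S) = affine_dim S"
proof -
  \<comment> \<open>\<open>L\<close> is the linear map on the homogenized space that acts as the
    affine map \<open>x\<close> to \<open>a + f x\<close> at height 1; the translation becomes
    linear by scaling \<open>a\<close> with the height.\<close>
  define L where "L = (\<lambda>(x, t::real). (t *\<^sub>R a + f x, t))"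
  have "linear L"
    unfolding L_def
    by (rule linearI) (auto simp: linear_add[OF assms(1)] linear_scale[OF assms(1)] algebra_simps)
  moreover have "inj L"
    using assms(2) by (auto simp: L_def inj_def)
  moreover have "homog ((\<lambda>x. a + f x) ` S) = L ` homog S"
    by (simp add: L_def image_image)
  ultimately show ?thesis
    by (simp add: affine_dim_eq_dim dim_injective_image)
qed

section \<open>Faces of convex hulls\<close>

text \<open>The hull consists of the segments joining the two sets. The endpoints are split off so
  that the remaining case is an open segment, the form in which the definition of a face can be
  applied.\<close>

lemma convex_hull_Un_subset:
  fixes S T :: "'a::real_vector set"
  assumes S: "convex S" and T: "convex T" and x: "x \<in> convex hull (S \<union> T)"
  shows "x \<in> S \<or> x \<in> T \<or> (\<exists>a\<in>S. \<exists>b\<in>T. x \<in> open_segment a b)"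
proof (cases "S = {} \<or> T = {}")
  case True
  then show ?thesis using assms by (auto simp: hull_same)
next
  case False
  \<comment> \<open>Two nonnegatively weighted points of a convex set merge into one point carrying
    the total weight. If that weight is 0, any point of the set serves.\<close>
  have comb: "\<exists>c\<in>C. u *\<^sub>R a + v *\<^sub>R b = (u + v) *\<^sub>R c"
    if C: "convex C" "a \<in> C" "b \<in> C" "0 \<le> u" "0 \<le> v" for C :: "'a set" and a b u v
  proof (cases "u + v = 0")
    case True
    then have "u = 0" "v = 0" using that by auto
    then show ?thesis using that by auto
  next
    case False
    have "(u / (u + v)) *\<^sub>R a + (v / (u + v)) *\<^sub>R b \<in> C"
      using that False by (intro convexD[OF C(1)]) (auto simp flip: add_divide_distrib)
    moreover have "u *\<^sub>R a + v *\<^sub>R b = (u + v) *\<^sub>R ((u / (u + v)) *\<^sub>R a + (v / (u + v)) *\<^sub>R b)"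
      using False by (simp add: scaleR_add_right)
    ultimately show ?thesis by blast
  qed
  \<comment> \<open>\<open>J\<close> collects all segments between the two sets; it is convex
    because the \<open>S\<close>-parts and the \<open>T\<close>-parts of two of its points merge
    separately by \<open>comb\<close>.\<close>
  define J where "J = {u *\<^sub>R a + v *\<^sub>R b | u v a b. a \<in> S \<and> b \<in> T \<and> 0 \<le> u \<and> 0 \<le> v \<and> u + v = (1::real)}"
  have "convex J"
    unfolding convex_def
  proof (intro ballI allI impI)
    fix x y :: 'a and s t :: real
    assume "x \<in> J" "y \<in> J" and st: "0 \<le> s" "0 \<le> t" "s + t = 1"
    then obtain u v a b u' v' a' b' where
      x: "x = u *\<^sub>R a + v *\<^sub>R b" "a \<in> S" "b \<in> T" "0 \<le> u" "0 \<le> v" "u + v = 1" and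
      y: "y = u' *\<^sub>R a' + v' *\<^sub>R b'" "a' \<in> S" "b' \<in> T" "0 \<le> u'" "0 \<le> v'" "u' + v' = 1"
      unfolding J_def by blast
    obtain a'' where a'': "a'' \<in> S" "(s * u) *\<^sub>R a + (t * u') *\<^sub>R a' = (s * u + t * u') *\<^sub>R a''"
      using comb[OF S x(2) y(2), of "s * u" "t * u'"] x y st by auto
    obtain b'' where b'': "b'' \<in> T" "(s * v) *\<^sub>R b + (t * v') *\<^sub>R b' = (s * v + t * v') *\<^sub>R b''"
      using comb[OF T x(3) y(3), of "s * v" "t * v'"] x y st by auto
    have "s *\<^sub>R x + t *\<^sub>R y = ((s * u) *\<^sub>R a + (t * u') *\<^sub>R a') + ((s * v) *\<^sub>R b + (t * v') *\<^sub>R b')"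
      by (simp add: x(1) y(1) scaleR_add_right)
    also have "\<dots> = (s * u + t * u') *\<^sub>R a'' + (s * v + t * v') *\<^sub>R b''"
      using a'' b'' by simp
    finally have eq: "s *\<^sub>R x + t *\<^sub>R y = (s * u + t * u') *\<^sub>R a'' + (s * v + t * v') *\<^sub>R b''" .
    have "(s * u + t * u') + (s * v + t * v') = s * (u + v) + t * (u' + v')"
      by (simp add: algebra_simps)
    then have "(s * u + t * u') + (s * v + t * v') = 1" using x y st by simp
    then show "s *\<^sub>R x + t *\<^sub>R y \<in> J"
      unfolding J_def using eq a''(1) b''(1) x(4,5) y(4,5) st(1,2)
      by (intro CollectI exI[of _ "s * u + t * u'"] exI[of _ "s * v + t * v'"] exI[of _ a''] exI[of _ b'']) auto
  qed
  moreover have "S \<union> T \<subseteq> J"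
  proof
    fix z assume z: "z \<in> S \<union> T"
    obtain a b where ab: "a \<in> S" "b \<in> T" using False by blast
    from z show "z \<in> J"
    proof
      assume "z \<in> S"
      then show ?thesis unfolding J_def using ab
        by (intro CollectI exI[of _ 1] exI[of _ 0] exI[of _ z] exI[of _ b]) auto
    next
      assume "z \<in> T"
      then show ?thesis unfolding J_def using ab
        by (intro CollectI exI[of _ 0] exI[of _ 1] exI[of _ a] exI[of _ z]) auto
    qed
  qed
  ultimately have "x \<in> J" using x hull_minimal[of "S \<union> T" J convex] by blast
  then obtain u v a b where ab: "x = u *\<^sub>R a + v *\<^sub>R b" "a \<in> S" "b \<in> T" "0 \<le> u" "0 \<le> v" "u + v = 1"
    unfolding J_def by blast
  show ?thesis
  proof (cases "u = 0 \<or> v = 0 \<or> a = b")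
    case True
    then show ?thesis using ab by (auto simp flip: scaleR_add_left)
  next
    case False
    moreover have "x = (1 - v) *\<^sub>R a + v *\<^sub>R b"
      using ab(1,6) by (metis add_diff_cancel_right')
    ultimately have "x \<in> open_segment a b"
      using ab(4-6) by (auto simp: in_segment intro!: exI[of _ v])
    then show ?thesis using ab by blast
  qed
qed

text \<open>A point of the face that is interior to a segment from \<open>S\<close> to
  \<open>T\<close> drags both endpoints into the face, so it is already generated by the traces of
  \<open>F\<close> on \<open>S\<close> and on \<open>T\<close>.\<close>

lemma face_of_convex_hull_Un:
  fixes S T :: "'a::real_vector set"
  assumes "convex S" "convex T" and F: "F face_of (convex hull (S \<union> T))"
  shows "F = convex hull ((F \<inter> S) \<union> (F \<inter> T))"
proof
  show "convex hull ((F \<inter> S) \<union> (F \<inter> T)) \<subseteq> F"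
    using face_of_imp_convex[OF F] by (intro hull_minimal) auto
  show "F \<subseteq> convex hull ((F \<inter> S) \<union> (F \<inter> T))"
  proof
    fix x assume x: "x \<in> F"
    then have "x \<in> convex hull (S \<union> T)" using F face_of_imp_subset by blast
    then consider "x \<in> S \<union> T" | a b where "a \<in> S" "b \<in> T" "x \<in> open_segment a b"
      using convex_hull_Un_subset[OF assms(1,2)] by blast
    then show "x \<in> convex hull ((F \<inter> S) \<union> (F \<inter> T))"
    proof cases
      case 1
      then show ?thesis using x by (intro hull_inc) auto
    next
      case (2 a b)
      have "a \<in> F" "b \<in> F"
        using face_ofD[OF F 2(3)] 2 x hull_inc[of a "S \<union> T"] hull_inc[of b "S \<union> T"] by auto
      then have "{a, b} \<subseteq> (F \<inter> S) \<union> (F \<inter> T)" using 2 by auto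
      then have "convex hull {a, b} \<subseteq> convex hull ((F \<inter> S) \<union> (F \<inter> T))" by (rule hull_mono)
      then show ?thesis using 2(3) by (auto simp: segment_convex_hull open_segment_def)
    qed
  qed
qed

text \<open>Induction on the generators: the hull is that of one point and a smaller polytope, and
  the slice of \<open>F\<close> by the smaller polytope is one of its faces. Consequently a face is
  determined by the generators it contains.\<close>

lemma face_of_finite_convex_hull:
  fixes V :: "'a::real_vector set"
  assumes "finite V" "F face_of (convex hull V)"
  shows "F = convex hull (F \<inter> V)"
  using assms
proof (induction V arbitrary: F)
  case empty
  then show ?case using face_of_imp_subset by fastforce
next
  case (insert a V)
  have eq: "convex hull (insert a V) = convex hull ({a} \<union> convex hull V)"
    using hull_Un_right[of convex "{a}" V] by simp
  have "F \<inter> convex hull V face_of (convex hull (insert a V)) \<inter> (convex hull V)"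
    using insert.prems by (intro face_of_slice) auto
  moreover have "convex hull (insert a V) \<inter> (convex hull V) = convex hull V"
    using hull_mono[of V "insert a V" convex] by auto
  ultimately have "F \<inter> convex hull V = convex hull (F \<inter> convex hull V \<inter> V)"
    using insert.IH by simp
  moreover have "F \<inter> convex hull V \<inter> V = F \<inter> V"
    using hull_subset[of V convex] by auto
  ultimately have IH: "F \<inter> convex hull V = convex hull (F \<inter> V)" by simp
  have "F = convex hull ((F \<inter> {a}) \<union> (F \<inter> convex hull V))"
    using insert.prems unfolding eq by (intro face_of_convex_hull_Un) auto
  also have "\<dots> = convex hull ((F \<inter> {a}) \<union> (F \<inter> V))"
    using hull_Un_right[of convex "F \<inter> {a}" "F \<inter> V"] by (simp add: IH)
  also have "(F \<inter> {a}) \<union> (F \<inter> V) = F \<inter> insert a V" by auto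
  finally show ?case .
qed

text \<open>Since \<open>extension_size\<close> is a \<open>card\<close>, comparisons of facet
  counts need finite sets. Each face is the hull of a subset of the finitely many
  generators.\<close>

lemma finite_facets_polytope:
  assumes "polytope S" shows "finite {F. is_facet F S}"
proof -
  obtain V where V: "finite V" "S = convex hull V" using assms polytope_def by blast
  have "{F. is_facet F S} \<subseteq> (\<lambda>W. convex hull W) ` Pow V"
  proof
    fix F assume "F \<in> {F. is_facet F S}"
    then have "F = convex hull (F \<inter> V)"
      using face_of_finite_convex_hull[OF V(1)] V(2) by (simp add: is_facet_def)
    then show "F \<in> (\<lambda>W. convex hull W) ` Pow V" by blast
  qed
  then show ?thesis using V(1) finite_subset by blast
qed

text \<open>In a generating set of least cardinality no point is redundant, so each one is extreme;
  conversely, extreme points occur in every generating set.\<close>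

lemma polytope_eq_convex_hull_extreme_points:
  assumes "polytope S"
  shows "finite {v. v extreme_point_of S}" "S = convex hull {v. v extreme_point_of S}"
proof -
  define P where "P = (\<lambda>V. finite V \<and> convex hull V = S)"
  have "\<exists>V. P V" using assms by (auto simp: P_def polytope_def)
  then obtain V where V: "P V" and min: "\<And>W. P W \<Longrightarrow> card V \<le> card W"
    using ex_has_least_nat[of P _ card] by blast
  have "V \<subseteq> {v. v extreme_point_of S}"
  proof
    fix v assume v: "v \<in> V"
    have "v \<notin> convex hull (V - {v})"
    proof
      assume "v \<in> convex hull (V - {v})"
      then have "P (V - {v})"
        using V v hull_redundant[of v convex "V - {v}"] by (simp add: P_def insert_absorb)
      then show False
        using min[of "V - {v}"] v V card_Diff1_less[of V v] by (simp add: P_def)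
    qed
    then have "v extreme_point_of convex hull (insert v (V - {v}))"
      using V by (intro extreme_point_of_convex_hull_insert) (auto simp: P_def)
    then show "v \<in> {v. v extreme_point_of S}"
      using V v by (simp add: P_def insert_absorb)
  qed
  moreover have "{v. v extreme_point_of S} \<subseteq> V"
    using V extreme_points_of_convex_hull[of V] by (auto simp: P_def)
  ultimately have "{v. v extreme_point_of S} = V" by auto
  then show "finite {v. v extreme_point_of S}" "S = convex hull {v. v extreme_point_of S}"
    using V by (auto simp: P_def)
qed

text \<open>An affine combination \<open>x\<close> of points of \<open>F\<close> is split by the
  sign of its coefficients into \<open>x + a n = (1 + a) p\<close> with \<open>p\<close> in
  \<open>F\<close> and, for positive \<open>a\<close>, also \<open>n\<close> in \<open>F\<close>.
  Then \<open>p\<close> lies strictly between \<open>x\<close> and \<open>n\<close> unless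
  \<open>x = n\<close>, and the face property at \<open>p\<close> gives \<open>x\<close>. The
  argument is purely algebraic, without relative interiors.\<close>

lemma face_of_eq_if_subset_affine_hull:
  fixes S :: "'a::real_vector set"
  assumes F: "F face_of S" and S: "S \<subseteq> affine hull F"
  shows "F = S"
proof
  show "F \<subseteq> S" using F by (rule face_of_imp_subset)
  have conv: "convex F" using F by (rule face_of_imp_convex)
  show "S \<subseteq> F"
  proof
    fix x assume x: "x \<in> S"
    then obtain T u where T: "finite T" "T \<subseteq> F" "sum u T = 1" "(\<Sum>v\<in>T. u v *\<^sub>R v) = x"
      using S unfolding affine_hull_explicit by blast
    \<comment> \<open>\<open>a\<close> is the total negative weight; as all weights sum to 1, the
      others sum to \<open>1 + a\<close>, which normalizes them to a convex combination.\<close>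
    define N where "N = {v \<in> T. u v < 0}"
    define a where "a = (\<Sum>v\<in>N. - u v)"
    have fin: "finite N" "finite (T - N)" using T(1) by (auto simp: N_def)
    have NT: "N \<subseteq> T" by (auto simp: N_def)
    have a0: "0 \<le> a" unfolding a_def by (intro sum_nonneg) (auto simp: N_def)
    have sumP: "sum u (T - N) = 1 + a"
      using sum.subset_diff[OF NT T(1), of u] T(3) by (simp add: a_def sum_negf)
    define p where "p = (\<Sum>v\<in>T - N. (u v / (1 + a)) *\<^sub>R v)"
    have p: "p \<in> F"
      unfolding p_def using conv fin T(2) a0 sumP
      by (intro convex_sum) (auto simp: N_def simp flip: sum_divide_distrib)
    have p': "(1 + a) *\<^sub>R p = (\<Sum>v\<in>T - N. u v *\<^sub>R v)"
      using a0 by (auto simp: p_def scaleR_sum_right intro!: sum.cong)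
    show "x \<in> F"
    proof (cases "a = 0")
      case True
      have "N = {}"
      proof (rule ccontr)
        assume "N \<noteq> {}"
        then have "0 < a" unfolding a_def using fin by (intro sum_pos) (auto simp: N_def)
        then show False using True by simp
      qed
      then show ?thesis using p p' T(4) True by simp
    next
      case False
      then have apos: "0 < a" using a0 by simp
      define n where "n = (\<Sum>v\<in>N. (- u v / a) *\<^sub>R v)"
      have n: "n \<in> F"
        unfolding n_def
      proof (rule convex_sum[OF fin(1) conv])
        show "(\<Sum>v\<in>N. - u v / a) = 1"
          using apos by (simp only: a_def flip: sum_divide_distrib) simp
        show "0 \<le> - u v / a" "v \<in> F" if "v \<in> N" for v
          using that apos T(2) NT by (auto simp: N_def divide_nonpos_pos)
      qed
      have n': "a *\<^sub>R n = - (\<Sum>v\<in>N. u v *\<^sub>R v)"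
        using apos by (auto simp: n_def scaleR_sum_right sum_negf intro!: sum.cong)
      have "x + a *\<^sub>R n = (1 + a) *\<^sub>R p"
        using sum.subset_diff[OF NT T(1), of "\<lambda>v. u v *\<^sub>R v"] T(4) n' p' by simp
      then have "p = (1 / (1 + a)) *\<^sub>R (x + a *\<^sub>R n)"
        using apos by simp
      then have pe: "p = (1 - a / (1 + a)) *\<^sub>R x + (a / (1 + a)) *\<^sub>R n"
        using apos by (simp add: scaleR_add_right field_simps)
      show ?thesis
      proof (cases "x = n")
        case False
        then have "p \<in> open_segment x n"
          using pe apos by (auto simp: in_segment intro!: exI[of _ "a / (1 + a)"])
        then show ?thesis
          using face_ofD[OF F _ x] n p \<open>F \<subseteq> S\<close> by blast
      qed (use n in simp)
    qed
  qed
qed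

lemma face_of_eq_if_dim_eq:
  assumes F: "F face_of S" and S: "S \<subseteq> convex hull V" "finite V"
    and dim: "dim (homog F) = dim (homog S)"
  shows "F = S"
proof (rule face_of_eq_if_subset_affine_hull[OF F])
  have "homog S \<subseteq> span (homog V)"
    using S(1) convex_hull_subset_affine_hull by (intro homog_subset_span) blast
  then have "homog S \<subseteq> span (homog F)"
    using dim_subset_spanned(2)[of "homog F" "homog S" "homog V"] dim S(2) face_of_imp_subset[OF F]
    by (simp add: image_mono)
  then show "S \<subseteq> affine hull F"
    by (auto simp: mem_affine_hull_iff_homog)
qed

section \<open>Facets of the join of two independent polytopes\<close>

lemma dim_homog_convex_hull: "dim (homog (convex hull S)) = dim (homog S)"
proof -
  have "span (homog (convex hull S)) = span (homog S)"
    unfolding affine_hull_eq_iff_homog[symmetric] by (rule affine_hull_convex_hull)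
  then have "dim (span (homog (convex hull S))) = dim (span (homog S))"
    by (rule arg_cong)
  then show ?thesis unfolding dim_span .
qed

text \<open>The span condition says that the affine hulls of \<open>S\<close> and \<open>T\<close>
  are disjoint and share no direction. It passes to subsets, so dimensions also add for the traces
  of a facet on \<open>S\<close> and \<open>T\<close>. For the upper bound it suffices to place
  every facet in a list of candidates.\<close>

lemma card_facets_convex_hull_Un:
  fixes S T :: "'a::real_vector set"
  assumes S: "polytope S" and T: "polytope T"
    and direct: "span (homog S) \<inter> span (homog T) = {0}"
  shows "card {F. is_facet F (convex hull (S \<union> T))}
    \<le> (card {F. is_facet F S} + of_bool (affine_dim S = 0))
       + (card {F. is_facet F T} + of_bool (affine_dim T = 0))"
proof -
  \<comment> \<open>The empty set plays the role of the facet of a point.\<close>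
  define G where "G = (\<lambda>X::'a set. {F. is_facet F X} \<union> (if affine_dim X = 0 then {{}} else {}))"
  have finG: "finite (G X)" if "polytope X" for X
    using that by (simp add: G_def finite_facets_polytope)
  have cardG: "card (G X) \<le> card {F. is_facet F X} + of_bool (affine_dim X = 0)" for X
    using card_Un_le[of "{F. is_facet F X}" "{{}}"] by (simp add: G_def)
  obtain V where V: "finite V" "S = convex hull V" using S polytope_def by blast
  obtain W where W: "finite W" "T = convex hull W" using T polytope_def by blast
  have conv: "convex S" "convex T" using V W by auto
  define H where "H = convex hull (S \<union> T)"
  have SH: "S \<subseteq> H" "T \<subseteq> H" unfolding H_def using hull_subset[of "S \<union> T" convex] by auto
  have homS: "homog S \<subseteq> span (homog V)" and homT: "homog T \<subseteq> span (homog W)"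
    using V(2) W(2) by (simp_all add: homog_subset_span convex_hull_subset_affine_hull)
  have dim_Un: "dim (homog (A \<union> B)) = dim (homog A) + dim (homog B)" if "A \<subseteq> S" "B \<subseteq> T" for A B
  proof -
    have "span (homog A) \<inter> span (homog B) \<subseteq> {0}"
      unfolding direct[symmetric] by (intro Int_mono span_mono image_mono that)
    then have "span (homog A) \<inter> span (homog B) = {0}"
      by (rule antisym) (simp add: span_0)
    moreover have "homog A \<subseteq> span (homog V \<union> homog W)"
      by (rule order.trans[OF image_mono[OF that(1)] order.trans[OF homS span_mono[OF Un_upper1]]])
    moreover have "homog B \<subseteq> span (homog V \<union> homog W)"
      by (rule order.trans[OF image_mono[OF that(2)] order.trans[OF homT span_mono[OF Un_upper2]]])
    ultimately show ?thesis
      using V(1) W(1) dim_Un_direct[of "homog A" "homog B" "homog V \<union> homog W"]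
      by (simp add: image_Un)
  qed
  \<comment> \<open>Here the off-by-one is settled: an empty \<open>F\<close> has homogenized
    dimension 0, which forces \<open>X\<close> to be a point, exactly when \<open>G X\<close>
    contains the empty set.\<close>
  have facet_cases: "F \<in> G X"
    if "F face_of X" "dim (homog F) + 1 = dim (homog X)" for F X
  proof (cases "F = {}")
    case True
    then have "dim (homog X) = 1"
      using that(2) dim_eq_card_independent[of "{}::('a \<times> real) set"]
      by (simp add: independent_empty)
    then show ?thesis using True by (simp add: G_def affine_dim_eq_dim)
  next
    case False
    then show ?thesis
      using that(1) arg_cong[OF that(2), of int] by (simp add: G_def is_facet_def affine_dim_eq_dim)
  qed
  have "{F. is_facet F H} \<subseteq> (\<lambda>F. convex hull (F \<union> T)) ` G S \<union> (\<lambda>F. convex hull (S \<union> F)) ` G T"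
  proof
    fix F assume "F \<in> {F. is_facet F H}"
    then have F: "F face_of H" and dimF: "affine_dim F = affine_dim H - 1"
      by (auto simp: is_facet_def)
    have F_eq: "F = convex hull ((F \<inter> S) \<union> (F \<inter> T))"
      using F unfolding H_def by (rule face_of_convex_hull_Un[OF conv])
    have faceS: "F \<inter> S face_of S" and faceT: "F \<inter> T face_of T"
      using face_of_slice[OF F conv(1)] face_of_slice[OF F conv(2)] SH by (simp_all add: Int_absorb1)
    have "dim (homog F) = dim (homog ((F \<inter> S) \<union> (F \<inter> T)))"
      by (rule trans[OF arg_cong[OF F_eq, of "\<lambda>X. dim (homog X)"] dim_homog_convex_hull])
    also have "\<dots> = dim (homog (F \<inter> S)) + dim (homog (F \<inter> T))"
      by (intro dim_Un) auto
    finally have "dim (homog F) = dim (homog (F \<inter> S)) + dim (homog (F \<inter> T))" .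
    moreover have "dim (homog H) = dim (homog S) + dim (homog T)"
      using dim_Un[of S T] by (simp add: H_def dim_homog_convex_hull)
    moreover have "dim (homog F) + 1 = dim (homog H)"
      using dimF by (simp add: affine_dim_eq_dim)
    moreover have "dim (homog (F \<inter> S)) \<le> dim (homog S)"
      using homS V(1) by (intro dim_subset_spanned(1)[of _ _ "homog V"]) auto
    moreover have "dim (homog (F \<inter> T)) \<le> dim (homog T)"
      using homT W(1) by (intro dim_subset_spanned(1)[of _ _ "homog W"]) auto
    \<comment> \<open>Neither trace exceeds the dimension of its part and the total deficit is one,
      so exactly one part loses a dimension and the other trace is a face of full dimension.\<close>
    ultimately have
      "dim (homog (F \<inter> T)) = dim (homog T) \<and> dim (homog (F \<inter> S)) + 1 = dim (homog S) \<or>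
       dim (homog (F \<inter> S)) = dim (homog S) \<and> dim (homog (F \<inter> T)) + 1 = dim (homog T)"
      by linarith
    then consider
      "dim (homog (F \<inter> T)) = dim (homog T)" "dim (homog (F \<inter> S)) + 1 = dim (homog S)" |
      "dim (homog (F \<inter> S)) = dim (homog S)" "dim (homog (F \<inter> T)) + 1 = dim (homog T)"
      by blast
    then show "F \<in> (\<lambda>F. convex hull (F \<union> T)) ` G S \<union> (\<lambda>F. convex hull (S \<union> F)) ` G T"
    proof cases
      case 1
      have FT: "F \<inter> T = T"
        using W 1 faceT by (intro face_of_eq_if_dim_eq[of _ _ W]) auto
      have "F = convex hull ((F \<inter> S) \<union> T)" using F_eq unfolding FT .
      then show ?thesis using facet_cases[OF faceS 1(2)] by blast
    next
      case 2
      have FS: "F \<inter> S = S"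
        using V 2 faceS by (intro face_of_eq_if_dim_eq[of _ _ V]) auto
      have "F = convex hull (S \<union> (F \<inter> T))" using F_eq unfolding FS .
      then show ?thesis using facet_cases[OF faceT 2(2)] by blast
    qed
  qed
  then have "card {F. is_facet F H}
      \<le> card ((\<lambda>F. convex hull (F \<union> T)) ` G S \<union> (\<lambda>F. convex hull (S \<union> F)) ` G T)"
    using finG S T by (intro card_mono) auto
  also have "\<dots> \<le> card (G S) + card (G T)"
    using finG[OF S] finG[OF T] by (intro order.trans[OF card_Un_le] add_mono card_image_le)
  also have "\<dots> \<le> (card {F. is_facet F S} + of_bool (affine_dim S = 0))
       + (card {F. is_facet F T} + of_bool (affine_dim T = 0))"
    using cardG[of S] cardG[of T] by (rule add_mono)
  finally show ?thesis by (simp add: H_def)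
qed

lemma card_facets_affine_image_le:
  assumes "linear f" "inj f" "polytope S"
  shows "card {F. is_facet F ((\<lambda>x. a + f x) ` S)} \<le> card {F. is_facet F S}"
proof -
  have "{F. is_facet F ((\<lambda>x. a + f x) ` S)} \<subseteq> (\<lambda>F. (\<lambda>x. a + f x) ` F) ` {F. is_facet F S}"
  proof
    fix F assume "F \<in> {F. is_facet F ((\<lambda>x. a + f x) ` S)}"
    then have F: "F face_of (\<lambda>x. a + f x) ` S" "F \<noteq> {}"
      "affine_dim F = affine_dim ((\<lambda>x. a + f x) ` S) - 1"
      by (auto simp: is_facet_def)
    obtain E where E: "F = (\<lambda>x. a + f x) ` E"
      using face_of_imp_subset[OF F(1)] by (auto simp: subset_image_iff)
    have image: "(\<lambda>x. a + f x) ` X = (+) a ` f ` X" for X by (simp add: image_image)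
    have "E face_of S"
      using F(1) by (simp only: E image face_of_translation_eq face_of_linear_image[OF assms(1,2)])
    then have "is_facet E S"
      using F E by (auto simp: is_facet_def affine_dim_affine_image[OF assms(1,2)])
    then show "F \<in> (\<lambda>F. (\<lambda>x. a + f x) ` F) ` {F. is_facet F S}" using E by blast
  qed
  then show ?thesis
    using finite_facets_polytope[OF assms(3)] by (rule surj_card_le[rotated])
qed

lemma affine_dim_empty: "affine_dim ({}::'a::real_vector set) = - 1"
  using dim_eq_card_independent[of "{}::('a \<times> real) set"]
  by (simp add: affine_dim_eq_dim independent_empty)

lemma affine_dim_eq_0_iff: "affine_dim S = 0 \<longleftrightarrow> (\<exists>a. S = {a})"
proof
  assume "affine_dim S = 0"
  then have dim: "dim (homog S) = 1" by (simp add: affine_dim_eq_dim)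
  obtain C where C: "C \<subseteq> homog S" "homog S \<subseteq> span C" "card C = dim (homog S)"
    by (rule basis_exists)
  then obtain c where c: "C = {c}" using dim by (auto simp: card_1_singleton_iff)
  then obtain a where a: "a \<in> S" "c = (a, 1)" using C(1) by auto
  have "x = a" if "x \<in> S" for x
  proof -
    have "(x, 1) \<in> span {(a, 1::real)}" using that C(2) c a(2) by auto
    then show ?thesis unfolding span_singleton by auto
  qed
  then show "\<exists>a. S = {a}" using a by blast
next
  assume "\<exists>a. S = {a}"
  then obtain a where "S = {a}" by blast
  then show "affine_dim S = 0"
    using dim_eq_card_independent[of "{(a, 1::real)}"]
    by (simp add: affine_dim_eq_dim zero_prod_def)
qed

section \<open>Coordinates\<close>

lemma lookup_scaleR: "Poly_Mapping.lookup (c *\<^sub>R x) i = c *\<^sub>R Poly_Mapping.lookup x i"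
  by (simp add: scaleR_poly_mapping_def)

lift_definition trunc :: "nat \<Rightarrow> rvec \<Rightarrow> rvec" is "\<lambda>n f i. if i < n then f i else 0"
  by (rule finite_subset) auto

lift_definition shift :: "nat \<Rightarrow> rvec \<Rightarrow> rvec" is "\<lambda>n f i. if i < n then 0 else f (i - n)"
proof -
  fix n :: nat and f :: "nat \<Rightarrow> real"
  assume "finite {x. f x \<noteq> 0}"
  moreover have "{i. (if i < n then 0 else f (i - n)) \<noteq> 0} \<subseteq> (+) n ` {x. f x \<noteq> 0}"
  proof
    fix i assume "i \<in> {i. (if i < n then 0 else f (i - n)) \<noteq> 0}"
    then have "i = n + (i - n)" "f (i - n) \<noteq> 0" by (auto split: if_splits)
    then show "i \<in> (+) n ` {x. f x \<noteq> 0}" by blast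
  qed
  ultimately show "finite {i. (if i < n then 0 else f (i - n)) \<noteq> 0}"
    by (meson finite_imageI finite_subset)
qed

lift_definition unshift :: "nat \<Rightarrow> rvec \<Rightarrow> rvec" is "\<lambda>n f i. f (i + n)"
proof -
  fix n :: nat and f :: "nat \<Rightarrow> real"
  assume "finite {x. f x \<noteq> 0}"
  then have "finite ((\<lambda>i. i + n) -` {x. f x \<noteq> 0})"
    by (rule finite_vimageI) (auto simp: inj_def)
  then show "finite {i. f (i + n) \<noteq> 0}" by (simp add: vimage_def)
qed

lemmas lookup_simps = lookup_add lookup_scaleR trunc.rep_eq shift.rep_eq unshift.rep_eq lookup_single

lemma linear_trunc: "linear (trunc n)" and linear_shift: "linear (shift n)"
  and linear_unshift: "linear (unshift n)"
  by (auto intro!: linearI poly_mapping_eqI simp: lookup_simps)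

lemma inj_shift: "inj (shift n)"
proof (rule injI)
  fix x y assume *: "shift n x = shift n y"
  show "x = y"
  proof (rule poly_mapping_eqI)
    fix i show "Poly_Mapping.lookup x i = Poly_Mapping.lookup y i"
      using arg_cong[OF *, of "\<lambda>z. Poly_Mapping.lookup z (i + n)"] by (simp add: lookup_simps)
  qed
qed

lemma mem_rspace_iff: "x \<in> rspace n \<longleftrightarrow> (\<forall>i\<ge>n. Poly_Mapping.lookup x i = 0)"
  by (auto simp: rspace_def in_keys_iff subset_iff) (metis not_le)

lemma rspace_mono: "m \<le> n \<Longrightarrow> rspace m \<subseteq> rspace n"
  by (auto simp: mem_rspace_iff)

lemma subspace_rspace: "subspace (rspace n)"
  by (auto simp: subspace_def mem_rspace_iff lookup_simps)

lemma trunc_ident: "x \<in> rspace n \<Longrightarrow> trunc n x = x"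
  by (intro poly_mapping_eqI) (auto simp: mem_rspace_iff lookup_simps)

lemma unshift_eq_0: "x \<in> rspace n \<Longrightarrow> n \<le> m \<Longrightarrow> unshift m x = 0"
  by (intro poly_mapping_eqI) (auto simp: mem_rspace_iff lookup_simps)

lemma rspace_eq_sum_single:
  assumes "x \<in> rspace n"
  shows "x = (\<Sum>j<n. Poly_Mapping.lookup x j *\<^sub>R Poly_Mapping.single j 1)"
proof (rule poly_mapping_eqI)
  fix i
  have "(\<Sum>j<n. Poly_Mapping.lookup x j * (1 when j = i)) = (\<Sum>j<n. if j = i then Poly_Mapping.lookup x i else 0)"
    by (intro sum.cong) auto
  then show "Poly_Mapping.lookup x i =
      Poly_Mapping.lookup (\<Sum>j<n. Poly_Mapping.lookup x j *\<^sub>R Poly_Mapping.single j 1) i"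
    using assms by (auto simp: lookup_sum lookup_simps mem_rspace_iff)
qed

section \<open>Polyhedra and 0/1-polytopes\<close>

text \<open>A linear functional on \<open>rspace q\<close> is determined by its values on the unit
  vectors; these values are the matrix row that \<open>is_polyhedron\<close> asks for.\<close>

lemma is_polyhedronI:
  fixes f :: "nat \<Rightarrow> rvec \<Rightarrow> real"
  assumes lin: "\<And>i. i < m \<Longrightarrow> linear (f i)"
  shows "is_polyhedron q {x \<in> rspace q. \<forall>i<m. f i x \<le> b i}"
  unfolding is_polyhedron_def
proof (intro exI)
  show "{x \<in> rspace q. \<forall>i<m. f i x \<le> b i} =
      {x \<in> rspace q. \<forall>i<m. (\<Sum>j<q. f i (Poly_Mapping.single j 1) * Poly_Mapping.lookup x j) \<le> b i}"
  proof (intro Collect_cong conj_cong refl all_cong)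
    fix x i assume x: "x \<in> rspace q" and i: "i < m"
    have "f i x = f i (\<Sum>j<q. Poly_Mapping.lookup x j *\<^sub>R Poly_Mapping.single j 1)"
      by (rule arg_cong[OF rspace_eq_sum_single[OF x]])
    also have "\<dots> = (\<Sum>j<q. f i (Poly_Mapping.single j 1) * Poly_Mapping.lookup x j)"
      using lin[OF i] by (simp add: linear_sum linear_scale mult.commute)
    finally show "(f i x \<le> b i) = ((\<Sum>j<q. f i (Poly_Mapping.single j 1) * Poly_Mapping.lookup x j) \<le> b i)"
      by simp
  qed
qed

lemma is_polyhedron_halfspace:
  assumes "linear (f :: rvec \<Rightarrow> real)"
  shows "is_polyhedron q {x \<in> rspace q. f x \<le> b}"
  using is_polyhedronI[of 1 "\<lambda>_. f" q "\<lambda>_. b"] assms by simp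

lemma is_polyhedron_Int:
  assumes "is_polyhedron q S" "is_polyhedron q T"
  shows "is_polyhedron q (S \<inter> T)"
proof -
  obtain m :: nat and A :: "nat \<Rightarrow> nat \<Rightarrow> real" and b where S: "S = {x \<in> rspace q. \<forall>i<m. (\<Sum>j<q. A i j * Poly_Mapping.lookup x j) \<le> b i}"
    using assms(1) unfolding is_polyhedron_def by blast
  obtain m' :: nat and A' :: "nat \<Rightarrow> nat \<Rightarrow> real" and b' where T: "T = {x \<in> rspace q. \<forall>i<m'. (\<Sum>j<q. A' i j * Poly_Mapping.lookup x j) \<le> b' i}"
    using assms(2) unfolding is_polyhedron_def by blast
  define C where "C = (\<lambda>i. if i < m then A i else A' (i - m))"
  define c where "c = (\<lambda>i. if i < m then b i else b' (i - m))"
  have split: "(\<forall>i<m + m'. R i) \<longleftrightarrow> (\<forall>i<m. R i) \<and> (\<forall>i<m'. R (m + i))" for R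
  proof (intro iffI conjI allI impI)
    fix i assume R: "(\<forall>i<m. R i) \<and> (\<forall>i<m'. R (m + i))" and i: "i < m + m'"
    show "R i"
    proof (cases "i < m")
      case False
      then have "R (m + (i - m))" using R i by (intro R[THEN conjunct2, rule_format]) linarith
      then show ?thesis using False by simp
    qed (use R in blast)
  qed auto
  have "S \<inter> T = {x \<in> rspace q. \<forall>i<m + m'. (\<Sum>j<q. C i j * Poly_Mapping.lookup x j) \<le> c i}"
    unfolding split by (auto simp: S T C_def c_def)
  then show ?thesis
    unfolding is_polyhedron_def by blast
qed

lemma is_polyhedron_imp_convex:
  assumes "is_polyhedron q Q" shows "convex Q"
proof -
  obtain m :: nat and A :: "nat \<Rightarrow> nat \<Rightarrow> real" and b where Q: "Q = {x \<in> rspace q. \<forall>i<m. (\<Sum>j<q. A i j * Poly_Mapping.lookup x j) \<le> b i}"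
    using assms unfolding is_polyhedron_def by blast
  show ?thesis
    unfolding convex_def
  proof (intro ballI allI impI)
    fix x y and u v :: real
    assume xy: "x \<in> Q" "y \<in> Q" and uv: "0 \<le> u" "0 \<le> v" "u + v = 1"
    have "u *\<^sub>R x + v *\<^sub>R y \<in> rspace q"
      using xy by (intro subspace_add subspace_scale subspace_rspace) (auto simp: Q)
    moreover have "(\<Sum>j<q. A i j * Poly_Mapping.lookup (u *\<^sub>R x + v *\<^sub>R y) j) \<le> b i" if "i < m" for i
    proof -
      have "(\<Sum>j<q. A i j * Poly_Mapping.lookup (u *\<^sub>R x + v *\<^sub>R y) j)
          = u * (\<Sum>j<q. A i j * Poly_Mapping.lookup x j) + v * (\<Sum>j<q. A i j * Poly_Mapping.lookup y j)"
        by (simp add: lookup_simps sum_distrib_left sum.distrib algebra_simps)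
      also have "\<dots> \<le> b i"
        using xy uv that by (intro convex_bound_le) (auto simp: Q)
      finally show ?thesis .
    qed
    ultimately show "u *\<^sub>R x + v *\<^sub>R y \<in> Q" by (simp add: Q)
  qed
qed

text \<open>A common bounding body: it contains all 0/1-polytopes, certifies 0/1-points as extreme,
  and supplies the bounds used to describe a join by inequalities.\<close>

definition unit_cube :: "nat \<Rightarrow> rvec set" where
  "unit_cube n = {x \<in> rspace n. \<forall>i<n. Poly_Mapping.lookup x i \<in> {0..1}}"

lemma convex_unit_cube: "convex (unit_cube n)"
  unfolding convex_def
proof (intro ballI allI impI)
  fix x y and u v :: real
  assume xy: "x \<in> unit_cube n" "y \<in> unit_cube n" and uv: "0 \<le> u" "0 \<le> v" "u + v = 1"
  then show "u *\<^sub>R x + v *\<^sub>R y \<in> unit_cube n"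
    using subspace_add[OF subspace_rspace[of n]] subspace_scale[OF subspace_rspace[of n]]
    by (auto simp: unit_cube_def lookup_simps intro!: convex_bound_le)
qed

text \<open>Each coordinate of \<open>v\<close> is an end of the interval from 0 to 1, and such an
  end is a proper convex combination only of itself.\<close>

lemma extreme_point_of_if_zero_one:
  assumes "v \<in> S" "S \<subseteq> unit_cube n" and v: "\<And>i. i < n \<Longrightarrow> Poly_Mapping.lookup v i \<in> {0, 1}"
  shows "v extreme_point_of S"
  unfolding extreme_point_of_def
proof (intro conjI ballI notI)
  fix a b assume ab: "a \<in> S" "b \<in> S" "v \<in> open_segment a b"
  then obtain u where u: "0 < u" "u < 1" and eq: "v = (1 - u) *\<^sub>R a + u *\<^sub>R b" and "a \<noteq> b"
    by (auto simp: in_segment)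
  have cube: "a \<in> unit_cube n" "b \<in> unit_cube n" using ab assms(2) by auto
  have "a = b"
  proof (rule poly_mapping_eqI)
    fix i
    show "Poly_Mapping.lookup a i = Poly_Mapping.lookup b i"
    proof (cases "i < n")
      case False
      then show ?thesis using cube by (simp add: unit_cube_def mem_rspace_iff)
    next
      case True
      define s t where "s = Poly_Mapping.lookup a i" "t = Poly_Mapping.lookup b i"
      have st: "0 \<le> s" "s \<le> 1" "0 \<le> t" "t \<le> 1"
        using cube True by (auto simp: unit_cube_def s_t_def)
      have "(1 - u) * s + u * t \<in> {0, 1}"
        using v[OF True] by (simp add: eq lookup_simps s_t_def)
      \<comment> \<open>Coordinate value 1 is recorded as a vanishing combination of
        \<open>1 - s\<close> and \<open>1 - t\<close>; both cases then reduce to a zero sum of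
        nonnegative terms.\<close>
      then consider "(1 - u) * s + u * t = 0" | "(1 - u) * (1 - s) + u * (1 - t) = 0"
        by (auto simp: algebra_simps)
      then have "s = t"
      proof cases
        case 1
        then have "(1 - u) * s = 0 \<and> u * t = 0"
          using u st by (subst (asm) add_nonneg_eq_0_iff) auto
        then show ?thesis using u by simp
      next
        case 2
        then have "(1 - u) * (1 - s) = 0 \<and> u * (1 - t) = 0"
          using u st by (subst (asm) add_nonneg_eq_0_iff) auto
        then show ?thesis using u by simp
      qed
      then show ?thesis by (simp add: s_t_def)
    qed
  qed
  then show False using \<open>a \<noteq> b\<close> by simp
qed (rule assms(1))

lemma zero_one_polytope_subset_unit_cube:
  assumes "zero_one_polytope p P" shows "P \<subseteq> unit_cube p"
proof -
  have "{v. v extreme_point_of P} \<subseteq> unit_cube p"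
  proof
    fix v assume "v \<in> {v. v extreme_point_of P}"
    then have "v \<in> P" "\<forall>i<p. Poly_Mapping.lookup v i \<in> {0, 1}" "P \<subseteq> rspace p"
      using assms by (auto simp: zero_one_polytope_def extreme_point_of_def)
    then show "v \<in> unit_cube p" by (force simp: unit_cube_def)
  qed
  then have "convex hull {v. v extreme_point_of P} \<subseteq> unit_cube p"
    using convex_unit_cube by (rule hull_minimal)
  moreover have "P = convex hull {v. v extreme_point_of P}"
    using assms by (intro polytope_eq_convex_hull_extreme_points) (simp add: zero_one_polytope_def)
  ultimately show ?thesis by (metis order.eq_iff order.trans)
qed

lemma extreme_point_of_subset: "v extreme_point_of S \<Longrightarrow> T \<subseteq> S \<Longrightarrow> v \<in> T \<Longrightarrow> v extreme_point_of T"
  by (auto simp: extreme_point_of_def)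

text \<open>For general polytopes a vertex of one part may be absorbed by the hull; 0/1-vertices are
  not, being vertices of the surrounding cube.\<close>

lemma extreme_point_of_convex_hull_Un:
  assumes P: "zero_one_polytope p P" "zero_one_polytope p P'"
  shows "v extreme_point_of (convex hull (P \<union> P')) \<longleftrightarrow> v extreme_point_of P \<or> v extreme_point_of P'"
proof
  have sub: "P \<union> P' \<subseteq> convex hull (P \<union> P')" by (rule hull_subset)
  assume "v extreme_point_of (convex hull (P \<union> P'))"
  then show "v extreme_point_of P \<or> v extreme_point_of P'"
    using extreme_point_of_convex_hull[of v "P \<union> P'"]
      extreme_point_of_subset[of v _ P] extreme_point_of_subset[of v _ P'] sub by blast
next
  have sub: "P \<union> P' \<subseteq> convex hull (P \<union> P')" by (rule hull_subset)
  assume v: "v extreme_point_of P \<or> v extreme_point_of P'"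
  show "v extreme_point_of (convex hull (P \<union> P'))"
  proof (rule extreme_point_of_if_zero_one)
    show "v \<in> convex hull (P \<union> P')"
      using v sub by (auto simp: extreme_point_of_def)
    show "convex hull (P \<union> P') \<subseteq> unit_cube p"
      using P zero_one_polytope_subset_unit_cube convex_unit_cube by (intro hull_minimal) auto
    show "Poly_Mapping.lookup v i \<in> {0, 1}" if "i < p" for i
      using v P that by (auto simp: zero_one_polytope_def)
  qed
qed

lemma polytope_convex_hull_Un:
  assumes "polytope S" "polytope T" shows "polytope (convex hull (S \<union> T))"
proof -
  obtain V W where "finite V" "S = convex hull V" "finite W" "T = convex hull W"
    using assms polytope_def by metis
  then show ?thesis
    using polytope_convex_hull[of "V \<union> W"] hull_Un_left[of convex V "convex hull W"]
      hull_Un_right[of convex V W] by simp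
qed

lemma zero_one_polytope_convex_hull_Un:
  assumes P: "zero_one_polytope p P" "zero_one_polytope p P'"
  shows "zero_one_polytope p (convex hull (P \<union> P'))"
proof -
  have "convex hull (P \<union> P') \<subseteq> rspace p"
    using P subspace_imp_convex[OF subspace_rspace] by (intro hull_minimal) (auto simp: zero_one_polytope_def)
  then show ?thesis
    using P polytope_convex_hull_Un[of P P'] extreme_point_of_convex_hull_Un[OF P]
    by (auto simp: zero_one_polytope_def)
qed

lemma zero_one_polytope_empty: "zero_one_polytope p {}"
  by (simp add: zero_one_polytope_def polytope_empty extreme_point_of_def)

lemma zero_one_polytope_sing:
  assumes "v \<in> rspace p" "\<And>i. i < p \<Longrightarrow> Poly_Mapping.lookup v i \<in> {0, 1}"
  shows "zero_one_polytope p {v}"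
  using assms by (auto simp: zero_one_polytope_def polytope_sing)

text \<open>Lets the first part of a join be viewed in the larger space: its new coordinates are all
  0, an admissible value.\<close>

lemma zero_one_polytope_mono:
  assumes "zero_one_polytope m P" "m \<le> n" shows "zero_one_polytope n P"
  unfolding zero_one_polytope_def
proof (intro conjI allI impI)
  show "P \<subseteq> rspace n" "polytope P"
    using assms rspace_mono[OF assms(2)] by (auto simp: zero_one_polytope_def)
  fix v i assume v: "v extreme_point_of P"
  then have "v \<in> rspace m"
    using assms(1) by (auto simp: zero_one_polytope_def extreme_point_of_def)
  then show "Poly_Mapping.lookup v i \<in> {0, 1}"
    using v assms(1) by (cases "i < m") (auto simp: zero_one_polytope_def mem_rspace_iff)
qed

section \<open>The join of two extensions\<close>

text \<open>
  The coordinates of \<open>\<real>\<^sup>m\<close> come first, coordinate \<open>m\<close> separates the two parts of the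
  join, and the second part is moved behind it.
\<close>

definition lifted :: "nat \<Rightarrow> rvec \<Rightarrow> rvec" where
  "lifted m x = Poly_Mapping.single m 1 + shift (Suc m) x"

lemma lookup_lifted:
  "Poly_Mapping.lookup (lifted m x) i =
     (if i < m then 0 else if i = m then 1 else Poly_Mapping.lookup x (i - Suc m))"
  by (auto simp: lifted_def lookup_simps when_def)

lemma lifted_image: "lifted m ` S = (+) (Poly_Mapping.single m 1) ` shift (Suc m) ` S"
  by (simp add: image_image lifted_def)

lemma lifted_mem_rspace: "x \<in> rspace n \<Longrightarrow> lifted m x \<in> rspace (Suc m + n)"
  by (auto simp: mem_rspace_iff lookup_lifted)

lemma trunc_lifted: "trunc m (lifted m x) = 0"
  by (intro poly_mapping_eqI) (auto simp: lookup_lifted lookup_simps)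

lemma unshift_lifted: "unshift (Suc m) (lifted m x) = x"
  by (intro poly_mapping_eqI) (auto simp: lookup_lifted lookup_simps)

lemma extreme_point_of_lifted_image:
  "w extreme_point_of lifted m ` S \<longleftrightarrow> (\<exists>v. w = lifted m v \<and> v extreme_point_of S)"
proof -
  have "lifted m ` {v} face_of lifted m ` S \<longleftrightarrow> {v} face_of S" for v
    by (simp only: lifted_image face_of_translation_eq face_of_linear_image[OF linear_shift inj_shift])
  then have iff: "lifted m v extreme_point_of lifted m ` S \<longleftrightarrow> v extreme_point_of S" for v
    by (simp add: face_of_singleton)
  show ?thesis
  proof
    assume w: "w extreme_point_of lifted m ` S"
    then have "w \<in> lifted m ` S" unfolding extreme_point_of_def by (rule conjunct1)
    then obtain v where "w = lifted m v" by (rule imageE)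
    then show "\<exists>v. w = lifted m v \<and> v extreme_point_of S" using w iff[of v] by blast
  qed (use iff in blast)
qed

lemma zero_one_polytope_lifted_image:
  assumes "zero_one_polytope n Q" shows "zero_one_polytope (Suc m + n) (lifted m ` Q)"
  unfolding zero_one_polytope_def
proof (intro conjI allI impI)
  show "lifted m ` Q \<subseteq> rspace (Suc m + n)"
    using assms lifted_mem_rspace by (auto simp: zero_one_polytope_def)
  show "polytope (lifted m ` Q)"
    using assms by (simp add: lifted_image polytope_translation_eq polytope_linear_image linear_shift
        zero_one_polytope_def)
  show "Poly_Mapping.lookup w i \<in> {0, 1}" if w: "w extreme_point_of lifted m ` Q" and i: "i < Suc m + n" for w i
  proof -
    obtain v where v: "w = lifted m v" "v extreme_point_of Q"
      using w extreme_point_of_lifted_image by blast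
    have "\<not> i \<le> m \<Longrightarrow> Poly_Mapping.lookup v (i - Suc m) \<in> {0, 1}"
      using assms v(2) i by (simp add: zero_one_polytope_def)
    then show ?thesis by (cases "i \<le> m") (auto simp: v(1) lookup_lifted)
  qed
qed

text \<open>This is the purpose of the separating coordinate. On the span of \<open>homog S\<close>
  the coordinates from \<open>m\<close> on vanish; on the other span the first \<open>m\<close>
  vanish and coordinate \<open>m\<close> equals the height \<open>t\<close>. A common vector has
  \<open>x = 0\<close>, hence also \<open>t = 0\<close>.\<close>

lemma span_homog_lifted_direct:
  assumes "S \<subseteq> rspace m"
  shows "span (homog S) \<inter> span (homog (lifted m ` T)) = {0}"
proof -
  have S: "span (homog S) \<subseteq> {(x, t). \<forall>i\<ge>m. Poly_Mapping.lookup x i = 0}"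
    using assms by (intro span_minimal) (auto simp: mem_rspace_iff subspace_def lookup_simps zero_prod_def)
  have T: "span (homog (lifted m ` T))
      \<subseteq> {(x, t). (\<forall>i<m. Poly_Mapping.lookup x i = 0) \<and> Poly_Mapping.lookup x m = t}"
    by (intro span_minimal) (auto simp: lookup_lifted subspace_def lookup_simps zero_prod_def)
  have "span (homog S) \<inter> span (homog (lifted m ` T)) \<subseteq> {0}"
  proof
    fix w assume w: "w \<in> span (homog S) \<inter> span (homog (lifted m ` T))"
    obtain x t where xt: "w = (x, t)" by (cases w)
    have x: "\<forall>i\<ge>m. Poly_Mapping.lookup x i = 0" "\<forall>i<m. Poly_Mapping.lookup x i = 0"
        "Poly_Mapping.lookup x m = t"
      using S T w unfolding xt by auto
    have "x = 0"
    proof (rule poly_mapping_eqI)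
      show "Poly_Mapping.lookup x i = Poly_Mapping.lookup 0 i" for i
        using x(1,2) by (cases "i < m") auto
    qed
    then show "w \<in> {0}" using x by (simp add: xt zero_prod_def)
  qed
  then show ?thesis
    by (rule antisym) (simp add: span_0)
qed

lemma linear_lookup: "linear (\<lambda>x::rvec. Poly_Mapping.lookup x i)"
  by (intro linearI) (simp_all add: lookup_simps)

text \<open>The shape of the rows of the join system: \<open>g\<close> selects one block of
  coordinates, and \<open>c\<close> multiplies the weight coordinate \<open>i\<close>.\<close>

lemma linear_lookup_combination:
  "linear (\<lambda>x::rvec. (\<Sum>j<q. A j * Poly_Mapping.lookup x (g j)) + c * Poly_Mapping.lookup x i)"
  by (intro linearI)
     (simp_all add: lookup_simps sum.distrib sum_distrib_left algebra_simps)

text \<open>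
  The 0/1-bounds, scaled by the weights of the two parts, force a part to vanish if its weight is
  zero; no recession cone argument is needed.
\<close>

lemma is_polyhedron_join:
  assumes Q: "is_polyhedron m Q" "Q \<subseteq> unit_cube m" and R: "is_polyhedron n R" "R \<subseteq> unit_cube n"
  shows "is_polyhedron (Suc m + n) (convex hull (Q \<union> lifted m ` R))"
proof -
  obtain k :: nat and A :: "nat \<Rightarrow> nat \<Rightarrow> real" and a
    where Q_eq: "Q = {x \<in> rspace m. \<forall>i<k. (\<Sum>j<m. A i j * Poly_Mapping.lookup x j) \<le> a i}"
    using Q(1) unfolding is_polyhedron_def by blast
  obtain l :: nat and B :: "nat \<Rightarrow> nat \<Rightarrow> real" and b
    where R_eq: "R = {x \<in> rspace n. \<forall>i<l. (\<Sum>j<n. B i j * Poly_Mapping.lookup x j) \<le> b i}"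
    using R(1) unfolding is_polyhedron_def by blast
  let ?U = "rspace (Suc m + n)"
  let ?x = "\<lambda>x::rvec. Poly_Mapping.lookup x"
  \<comment> \<open>The disjunctive programming description of the hull of two polytopes. With
    \<open>t\<close> for coordinate \<open>m\<close>, \<open>y\<close> for the first block and
    \<open>z\<close> for the last, it reads \<open>A y \<le> (1 - t) a\<close>,
    \<open>B z \<le> t b\<close>, \<open>0 \<le> y \<le> 1 - t\<close>,
    \<open>0 \<le> z \<le> t\<close>, \<open>0 \<le> t \<le> 1\<close>.\<close>
  define J where "J =
    {x \<in> ?U. \<forall>i<k. (\<Sum>j<m. A i j * ?x x j) + a i * ?x x m \<le> a i} \<inter>
    {x \<in> ?U. \<forall>i<l. (\<Sum>j<n. B i j * ?x x (j + Suc m)) + (- b i) * ?x x m \<le> 0} \<inter>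
    {x \<in> ?U. \<forall>j<m. - ?x x j \<le> 0} \<inter>
    {x \<in> ?U. \<forall>j<m. ?x x j + ?x x m \<le> 1} \<inter>
    {x \<in> ?U. \<forall>j<n. - ?x x (j + Suc m) \<le> 0} \<inter>
    {x \<in> ?U. \<forall>j<n. ?x x (j + Suc m) - ?x x m \<le> 0} \<inter>
    {x \<in> ?U. - ?x x m \<le> 0} \<inter> {x \<in> ?U. ?x x m \<le> 1}"
  have poly: "is_polyhedron (Suc m + n) J"
    unfolding J_def
    by (intro is_polyhedron_Int is_polyhedronI is_polyhedron_halfspace linear_lookup_combination
        linear_lookup linear_compose_neg linear_compose_add linear_compose_sub)
  have "J = convex hull (Q \<union> lifted m ` R)"
  proof
    show "convex hull (Q \<union> lifted m ` R) \<subseteq> J"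
    proof (rule hull_minimal)
      show "convex J" using poly by (rule is_polyhedron_imp_convex)
      have "x \<in> J" if "x \<in> Q" for x
      proof -
        have "x \<in> ?U" "x \<in> rspace m" using that rspace_mono[of m "Suc m + n"] by (auto simp: Q_eq)
        moreover have "\<forall>j<m. ?x x j \<in> {0..1}" using that Q(2) by (auto simp: unit_cube_def)
        ultimately show ?thesis
          using that by (auto simp: J_def Q_eq mem_rspace_iff)
      qed
      moreover have "lifted m y \<in> J" if "y \<in> R" for y
      proof -
        have "lifted m y \<in> ?U" using that lifted_mem_rspace by (auto simp: R_eq)
        moreover have "\<forall>j<n. ?x y j \<in> {0..1}" using that R(2) by (auto simp: unit_cube_def)
        ultimately show ?thesis
          using that by (auto simp: J_def R_eq lookup_lifted)
      qed
      ultimately show "Q \<union> lifted m ` R \<subseteq> J" by auto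
    qed
  next
    show "J \<subseteq> convex hull (Q \<union> lifted m ` R)"
    proof
      fix x assume x: "x \<in> J"
      define t where "t = ?x x m"
      define y where "y = trunc m x"
      define z where "z = unshift (Suc m) x"
      have xU: "x \<in> ?U" and t: "0 \<le> t" "t \<le> 1"
        and A: "\<And>i. i < k \<Longrightarrow> (\<Sum>j<m. A i j * ?x x j) \<le> (1 - t) * a i"
        and B: "\<And>i. i < l \<Longrightarrow> (\<Sum>j<n. B i j * ?x x (j + Suc m)) \<le> t * b i"
        and y01: "\<And>j. j < m \<Longrightarrow> 0 \<le> ?x x j \<and> ?x x j \<le> 1 - t"
        and z01: "\<And>j. j < n \<Longrightarrow> 0 \<le> ?x x (j + Suc m) \<and> ?x x (j + Suc m) \<le> t"
        using x by (force simp: J_def t_def algebra_simps)+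
      have x_eq: "x = y + t *\<^sub>R Poly_Mapping.single m 1 + shift (Suc m) z"
        by (intro poly_mapping_eqI)
           (auto simp: y_def z_def t_def lookup_simps when_def not_less_eq less_Suc_eq)
      \<comment> \<open>Dividing a block by its weight turns the homogenized rows back into the
        original system.\<close>
      have yQ: "(1 / (1 - t)) *\<^sub>R y \<in> Q" if "t < 1"
      proof -
        have "(\<Sum>j<m. A i j * ?x ((1 / (1 - t)) *\<^sub>R y) j) \<le> a i" if "i < k" for i
        proof -
          have "(\<Sum>j<m. A i j * ?x ((1 / (1 - t)) *\<^sub>R y) j) = (\<Sum>j<m. A i j * ?x x j) / (1 - t)"
            by (simp add: y_def lookup_simps sum_divide_distrib)
          then show ?thesis
            using A[OF \<open>i < k\<close>] \<open>t < 1\<close> by (simp add: pos_divide_le_eq mult.commute)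
        qed
        then show ?thesis by (simp add: Q_eq mem_rspace_iff y_def lookup_simps)
      qed
      have zR: "(1 / t) *\<^sub>R z \<in> R" if "0 < t"
      proof -
        have "(\<Sum>j<n. B i j * ?x ((1 / t) *\<^sub>R z) j) \<le> b i" if "i < l" for i
        proof -
          have "(\<Sum>j<n. B i j * ?x ((1 / t) *\<^sub>R z) j) = (\<Sum>j<n. B i j * ?x x (j + Suc m)) / t"
            by (simp add: z_def lookup_simps sum_divide_distrib)
          then show ?thesis
            using B[OF \<open>i < l\<close>] \<open>0 < t\<close> by (simp add: pos_divide_le_eq mult.commute)
        qed
        then show ?thesis using xU by (simp add: R_eq mem_rspace_iff z_def lookup_simps)
      qed
      have incl: "Q \<subseteq> convex hull (Q \<union> lifted m ` R)" "lifted m ` R \<subseteq> convex hull (Q \<union> lifted m ` R)"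
        using hull_subset[of "Q \<union> lifted m ` R" convex] by auto
      consider "t = 0" | "t = 1" | "0 < t" "t < 1" using t by linarith
      then show "x \<in> convex hull (Q \<union> lifted m ` R)"
      proof cases
        case 1
        have "z = 0"
        proof (rule poly_mapping_eqI)
          show "?x z j = ?x 0 j" for j
            using z01[of j] xU 1 by (cases "j < n") (auto simp: z_def lookup_simps mem_rspace_iff)
        qed
        then have "x = y" using x_eq 1 linear_0[OF linear_shift] by simp
        then show ?thesis using yQ 1 incl by auto
      next
        case 2
        have "y = 0"
        proof (rule poly_mapping_eqI)
          show "?x y j = ?x 0 j" for j
            using y01[of j] 2 by (auto simp: y_def lookup_simps)
        qed
        then have "x = lifted m z" using x_eq 2 by (simp add: lifted_def)
        then show ?thesis using zR 2 incl by auto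
      next
        case 3
        have "(1 - t) *\<^sub>R ((1 / (1 - t)) *\<^sub>R y) + t *\<^sub>R lifted m ((1 / t) *\<^sub>R z)
            = y + t *\<^sub>R Poly_Mapping.single m 1 + shift (Suc m) z"
          using 3 by (simp add: lifted_def scaleR_add_right linear_scale[OF linear_shift] add.assoc)
        then have "x = (1 - t) *\<^sub>R ((1 / (1 - t)) *\<^sub>R y) + t *\<^sub>R lifted m ((1 / t) *\<^sub>R z)"
          by (simp only: x_eq[symmetric])
        also have "\<dots> \<in> convex hull (Q \<union> lifted m ` R)"
          using yQ zR 3 incl by (intro convexD[OF convex_convex_hull]) auto
        finally show ?thesis .
      qed
    qed
  qed
  then show ?thesis using poly by simp
qed

text \<open>The vertices of the join are those of \<open>Q\<close> and the lifted ones of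
  \<open>R\<close>, and they map to vertices of \<open>P\<close> and of \<open>P'\<close>
  respectively. Without a common vertex, the preimages of a given vertex come from one part only,
  where uniqueness is known.\<close>

lemma nice_zero_one_extension_join:
  assumes P: "zero_one_polytope p P" "zero_one_polytope p P'"
    and disj: "\<And>v. \<not> (v extreme_point_of P \<and> v extreme_point_of P')"
    and nice: "nice_zero_one_extension p P m Q \<pi>" "nice_zero_one_extension p P' n R \<rho>"
  obtains \<sigma> where
    "nice_zero_one_extension p (convex hull (P \<union> P')) (Suc m + n) (convex hull (Q \<union> lifted m ` R)) \<sigma>"
proof
  \<comment> \<open>\<open>\<sigma>\<close> forgets the separating coordinate \<open>m\<close>. On
    each part the other block is zero, so \<open>\<sigma>\<close> restricts to \<open>\<pi>\<close>
    on \<open>Q\<close> and to \<open>\<rho>\<close> on the lifted copy of \<open>R\<close>.\<close>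
  define \<sigma> where "\<sigma> = (\<lambda>x. \<pi> (trunc m x) + \<rho> (unshift (Suc m) x))"
  let ?J = "convex hull (Q \<union> lifted m ` R)" and ?P = "convex hull (P \<union> P')"
  have Q: "is_polyhedron m Q" "linear \<pi>" "\<pi> ` rspace m \<subseteq> rspace p" "\<pi> ` Q = P" "zero_one_polytope m Q"
    and R: "is_polyhedron n R" "linear \<rho>" "\<rho> ` rspace n \<subseteq> rspace p" "\<rho> ` R = P'" "zero_one_polytope n R"
    using nice by (auto simp: nice_zero_one_extension_def is_extension_def)
  have linear: "linear \<sigma>"
    unfolding \<sigma>_def
    using linear_compose[OF linear_trunc Q(2)] linear_compose[OF linear_unshift R(2)]
    by (intro linear_compose_add) (simp_all add: o_def)
  have \<sigma>Q: "\<sigma> x = \<pi> x" if "x \<in> Q" for x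
  proof -
    have "x \<in> rspace m" using that Q(5) by (auto simp: zero_one_polytope_def)
    then show ?thesis
      by (simp add: \<sigma>_def trunc_ident unshift_eq_0 linear_0[OF R(2)])
  qed
  have \<sigma>R: "\<sigma> (lifted m y) = \<rho> y" for y
    by (simp add: \<sigma>_def trunc_lifted unshift_lifted linear_0[OF Q(2)])
  have rspace: "\<sigma> ` rspace (Suc m + n) \<subseteq> rspace p"
  proof clarify
    fix x assume x: "x \<in> rspace (Suc m + n)"
    have "trunc m x \<in> rspace m" by (simp add: mem_rspace_iff lookup_simps)
    moreover have "unshift (Suc m) x \<in> rspace n" using x by (simp add: mem_rspace_iff lookup_simps)
    ultimately show "\<sigma> x \<in> rspace p"
      unfolding \<sigma>_def using Q(3) R(3) by (intro subspace_add[OF subspace_rspace]) auto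
  qed
  have "\<sigma> ` (Q \<union> lifted m ` R) = P \<union> P'"
    unfolding image_Un using \<sigma>Q \<sigma>R Q(4) R(4) by (simp add: image_image)
  then have image: "\<sigma> ` ?J = ?P"
    by (simp add: convex_hull_linear_image[OF linear])
  have Q': "zero_one_polytope (Suc m + n) Q" and R': "zero_one_polytope (Suc m + n) (lifted m ` R)"
    using zero_one_polytope_mono[OF Q(5)] zero_one_polytope_lifted_image[OF R(5)] by simp_all
  have ext: "w extreme_point_of ?J \<longleftrightarrow> w extreme_point_of Q \<or> (\<exists>y. w = lifted m y \<and> y extreme_point_of R)" for w
    using extreme_point_of_convex_hull_Un[OF Q' R'] by (simp add: extreme_point_of_lifted_image)
  have extP: "v extreme_point_of ?P \<longleftrightarrow> v extreme_point_of P \<or> v extreme_point_of P'" for v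
    by (rule extreme_point_of_convex_hull_Un[OF P])
  have niceQ: "\<sigma> w = \<pi> w" "\<pi> w extreme_point_of P" if "w extreme_point_of Q" for w
    using that nice(1) \<sigma>Q[of w]
    by (simp_all add: nice_zero_one_extension_def extreme_point_of_def[of w])
  have niceR: "\<rho> w extreme_point_of P'" if "w extreme_point_of R" for w
    using that nice(2) by (auto simp: nice_zero_one_extension_def)
  have unique: "\<exists>!w. w extreme_point_of ?J \<and> \<sigma> w = v" if v: "v extreme_point_of ?P" for v
  proof (cases "v extreme_point_of P")
    case True
    then have "\<exists>!w. w extreme_point_of Q \<and> \<pi> w = v"
      using nice(1) by (simp add: nice_zero_one_extension_def)
    moreover have not_R: "\<sigma> (lifted m y) \<noteq> v" if "y extreme_point_of R" for y
      using niceR[OF that] disj[of v] True by (auto simp: \<sigma>R)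
    have "w extreme_point_of ?J \<and> \<sigma> w = v \<longleftrightarrow> w extreme_point_of Q \<and> \<pi> w = v" for w
      unfolding ext using niceQ(1)[of w] not_R by auto
    ultimately show ?thesis by simp
  next
    case False
    then have "\<exists>!w. w extreme_point_of R \<and> \<rho> w = v"
      using nice(2) extP v by (simp add: nice_zero_one_extension_def)
    then obtain y where y: "y extreme_point_of R" "\<rho> y = v"
      and y_unique: "\<And>y'. y' extreme_point_of R \<Longrightarrow> \<rho> y' = v \<Longrightarrow> y' = y"
      by blast
    have not_Q: "\<sigma> w \<noteq> v" if "w extreme_point_of Q" for w
      using niceQ[OF that] False by auto
    show ?thesis
    proof (rule ex1I[of _ "lifted m y"])
      show "lifted m y extreme_point_of ?J \<and> \<sigma> (lifted m y) = v"
        unfolding ext using y by (auto simp: \<sigma>R)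
      show "w = lifted m y" if "w extreme_point_of ?J \<and> \<sigma> w = v" for w
        using that not_Q y_unique unfolding ext by (auto simp: \<sigma>R)
    qed
  qed
  show "nice_zero_one_extension p ?P (Suc m + n) ?J \<sigma>"
    unfolding nice_zero_one_extension_def is_extension_def
  proof (intro conjI allI impI)
    show "is_polyhedron (Suc m + n) ?J"
      using Q R by (intro is_polyhedron_join zero_one_polytope_subset_unit_cube)
    show "zero_one_polytope (Suc m + n) ?J"
      using Q' R' by (rule zero_one_polytope_convex_hull_Un)
    show "\<sigma> w extreme_point_of ?P" if "w extreme_point_of ?J" for w
      using that niceQ niceR unfolding ext extP by (auto simp: \<sigma>R)
  qed (use linear rspace image unique in auto)
qed

lemma extension_size_join:
  assumes "zero_one_polytope m Q" "zero_one_polytope n R"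
  shows "extension_size (convex hull (Q \<union> lifted m ` R))
    \<le> (extension_size Q + of_bool (affine_dim Q = 0)) + (extension_size R + of_bool (affine_dim R = 0))"
proof -
  have lift: "lifted m ` R = (\<lambda>x. Poly_Mapping.single m 1 + shift (Suc m) x) ` R"
    by (simp add: lifted_def)
  have "extension_size (convex hull (Q \<union> lifted m ` R))
      \<le> (extension_size Q + of_bool (affine_dim Q = 0))
        + (extension_size (lifted m ` R) + of_bool (affine_dim (lifted m ` R) = 0))"
    unfolding extension_size_def
  proof (rule card_facets_convex_hull_Un)
    show "polytope Q" "polytope (lifted m ` R)" "span (homog Q) \<inter> span (homog (lifted m ` R)) = {0}"
      using assms zero_one_polytope_lifted_image[of n R m] span_homog_lifted_direct[of Q m R]
      by (auto simp: zero_one_polytope_def)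
  qed
  moreover have "affine_dim (lifted m ` R) = affine_dim R"
    unfolding lift by (rule affine_dim_affine_image[OF linear_shift inj_shift])
  moreover have "extension_size (lifted m ` R) \<le> extension_size R"
    unfolding lift extension_size_def using assms(2)
    by (intro card_facets_affine_image_le linear_shift inj_shift) (simp add: zero_one_polytope_def)
  ultimately show ?thesis by simp
qed

section \<open>The bound for nice 0/1-extensions\<close>

lemma nice_zero_one_extension_empty: "nice_zero_one_extension p {} 0 {} (\<lambda>x. x)"
proof -
  have "is_polyhedron 0 {}"
    \<comment> \<open>The unsatisfiable inequality \<open>0 \<le> - 1\<close> describes the empty
      set.\<close>
    using is_polyhedron_halfspace[of "\<lambda>_. 0" 0 "- 1"] by (simp add: linear_zero)
  moreover have "rspace 0 \<subseteq> rspace p" by (rule rspace_mono) simp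
  ultimately show ?thesis
    by (auto simp: nice_zero_one_extension_def is_extension_def zero_one_polytope_empty
        extreme_point_of_def linear_ident)
qed

lemma nice_zero_one_extension_sing:
  assumes "zero_one_polytope p {v}"
  shows "nice_zero_one_extension p {v} p {v} (\<lambda>x. x)"
proof -
  have v: "v \<in> rspace p" using assms by (simp add: zero_one_polytope_def)
  have "{v} = {x \<in> rspace p. \<forall>i<p. Poly_Mapping.lookup x i \<le> Poly_Mapping.lookup v i} \<inter>
      {x \<in> rspace p. \<forall>i<p. - Poly_Mapping.lookup x i \<le> - Poly_Mapping.lookup v i}"
  proof (intro antisym subsetI)
    fix x assume x: "x \<in> {x \<in> rspace p. \<forall>i<p. Poly_Mapping.lookup x i \<le> Poly_Mapping.lookup v i} \<inter>
      {x \<in> rspace p. \<forall>i<p. - Poly_Mapping.lookup x i \<le> - Poly_Mapping.lookup v i}"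
    have "x = v"
    proof (rule poly_mapping_eqI)
      show "Poly_Mapping.lookup x i = Poly_Mapping.lookup v i" for i
        using x v by (cases "i < p") (auto simp: mem_rspace_iff intro: antisym)
    qed
    then show "x \<in> {v}" by simp
  qed (use v in auto)
  moreover have "is_polyhedron p \<dots>"
    by (intro is_polyhedron_Int is_polyhedronI linear_lookup linear_compose_neg)
  ultimately have "is_polyhedron p {v}" by simp
  then show ?thesis
    using assms by (auto simp: nice_zero_one_extension_def is_extension_def linear_ident
        extreme_point_of_def)
qed

text \<open>Joining the vertices one by one, each as its own extension, yields a simplex lying over
  \<open>P\<close>. This avoids deriving an inequality description of \<open>P\<close>
  itself.\<close>

lemma nice_zero_one_extension_exists:
  assumes "zero_one_polytope p P"
  shows "\<exists>q Q \<pi>. nice_zero_one_extension p P q Q \<pi>"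
proof -
  have poly: "polytope P" using assms by (simp add: zero_one_polytope_def)
  have "zero_one_polytope p (convex hull V) \<and> (\<exists>q Q \<pi>. nice_zero_one_extension p (convex hull V) q Q \<pi>)"
    if "finite V" "\<And>v. v \<in> V \<Longrightarrow> zero_one_polytope p {v}" for V
    using that
  proof (induction V)
    case empty
    then show ?case
      using nice_zero_one_extension_empty zero_one_polytope_empty by auto
  next
    case (insert v V)
    then have V: "zero_one_polytope p (convex hull V)" and v: "zero_one_polytope p {v}" by auto
    obtain q Q \<pi> where nice: "nice_zero_one_extension p (convex hull V) q Q \<pi>"
      using insert by auto
    have disj: "\<not> (u extreme_point_of {v} \<and> u extreme_point_of convex hull V)" for u
      using insert(2) extreme_point_of_convex_hull[of u V] by auto
    have eq: "convex hull (insert v V) = convex hull ({v} \<union> convex hull V)"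
      using hull_Un_right[of convex "{v}" V] by simp
    show ?case
      unfolding eq using zero_one_polytope_convex_hull_Un[OF v V]
        nice_zero_one_extension_join[OF v V disj nice_zero_one_extension_sing[OF v] nice] by blast
  qed
  moreover note polytope_eq_convex_hull_extreme_points(1)[OF poly]
  moreover have "zero_one_polytope p {v}" if "v extreme_point_of P" for v
    using assms that
    by (intro zero_one_polytope_sing) (auto simp: zero_one_polytope_def extreme_point_of_def)
  ultimately have "\<exists>q Q \<pi>. nice_zero_one_extension p (convex hull {v. v extreme_point_of P}) q Q \<pi>"
    by blast
  then show ?thesis
    unfolding polytope_eq_convex_hull_extreme_points(2)[OF poly, symmetric] .
qed

section \<open>The minimum \<open>xc_star\<close> and its subadditivity\<close>

lemma xc_star_attained:
  assumes "zero_one_polytope p P"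
  obtains q Q \<pi> where "nice_zero_one_extension p P q Q \<pi>" "xc_star p P = extension_size Q"
proof -
  have "\<exists>q Q \<pi>. nice_zero_one_extension p P q Q \<pi> \<and> xc_star p P = extension_size Q"
    unfolding xc_star_def
    by (rule LeastI_ex) (use nice_zero_one_extension_exists[OF assms] in blast)
  then show ?thesis using that by blast
qed

lemma xc_star_le: "nice_zero_one_extension p P q Q \<pi> \<Longrightarrow> xc_star p P \<le> extension_size Q"
  unfolding xc_star_def by (intro Least_le) blast

lemma xc_star_empty: "xc_star p {} = 0"
proof -
  have "{F. is_facet F ({}::rvec set)} = {}"
    using face_of_imp_subset by (auto simp: is_facet_def)
  then show ?thesis
    using xc_star_le[OF nice_zero_one_extension_empty, of p] by (simp add: extension_size_def)
qed

text \<open>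
  Counting a point with value one makes the bound subadditive, so that the correction term need not
  be carried along for the intermediate hulls.
\<close>

definition weight :: "nat \<Rightarrow> rvec set \<Rightarrow> nat" where
  "weight p P = xc_star p P + of_bool (affine_dim P = 0)"

text \<open>If the hull is not a point, its weight is just \<open>xc_star\<close>, and the join of
  two optimal extensions bounds it. If it is a point, one of the two polytopes must be empty, as
  otherwise both would have that point as a vertex; the hull is then the other polytope.\<close>

lemma weight_convex_hull_Un:
  assumes P: "zero_one_polytope p P" "zero_one_polytope p P'"
    and disj: "\<And>v. \<not> (v extreme_point_of P \<and> v extreme_point_of P')"
  shows "weight p (convex hull (P \<union> P')) \<le> weight p P + weight p P'"
proof (cases "affine_dim (convex hull (P \<union> P')) = 0")
  case True
  then obtain a where a: "convex hull (P \<union> P') = {a}" by (auto simp: affine_dim_eq_0_iff)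
  then have sub: "P \<subseteq> {a}" "P' \<subseteq> {a}" using hull_subset[of "P \<union> P'" convex] by auto
  have "P = {} \<or> P' = {}"
  proof (rule ccontr)
    assume "\<not> ?thesis"
    then have "P = {a}" "P' = {a}" using sub by auto
    then show False using disj[of a] by (simp add: extreme_point_of_def)
  qed
  then have "convex hull (P \<union> P') = P' \<or> convex hull (P \<union> P') = P"
    using P hull_same[of convex P] hull_same[of convex P']
    by (auto simp: zero_one_polytope_def polytope_imp_convex)
  then show ?thesis by auto
next
  case False
  obtain m Q \<pi> where Q: "nice_zero_one_extension p P m Q \<pi>" "xc_star p P = extension_size Q"
    using xc_star_attained[OF P(1)] .
  obtain n R \<rho> where R: "nice_zero_one_extension p P' n R \<rho>" "xc_star p P' = extension_size R"
    using xc_star_attained[OF P(2)] .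
  \<comment> \<open>The facet count charges a correction when \<open>Q\<close> or \<open>R\<close>
    is a point. Then its image under the projection is a point too, so the correction is covered by
    the weight of \<open>P\<close> or \<open>P'\<close>.\<close>
  have dim: "affine_dim P = 0 \<or> affine_dim Q \<noteq> 0" "affine_dim P' = 0 \<or> affine_dim R \<noteq> 0"
    using Q(1) R(1) by (auto simp: nice_zero_one_extension_def is_extension_def affine_dim_eq_0_iff)
  obtain \<sigma> where "nice_zero_one_extension p (convex hull (P \<union> P')) (Suc m + n)
      (convex hull (Q \<union> lifted m ` R)) \<sigma>"
    using nice_zero_one_extension_join[OF P disj Q(1) R(1)] .
  then have "xc_star p (convex hull (P \<union> P')) \<le> extension_size (convex hull (Q \<union> lifted m ` R))"
    by (rule xc_star_le)
  also have "\<dots> \<le> (extension_size Q + of_bool (affine_dim Q = 0))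
      + (extension_size R + of_bool (affine_dim R = 0))"
    using Q(1) R(1) by (intro extension_size_join[of m _ n]) (auto simp: nice_zero_one_extension_def)
  also have "\<dots> \<le> weight p P + weight p P'"
    using dim by (auto simp: weight_def Q(2) R(2))
  finally show ?thesis using False by (simp add: weight_def)
qed

theorem theorem2p6:
  fixes p k :: nat and P :: "nat \<Rightarrow> rvec set"
  assumes "\<And>i. i \<in> {1..k} \<Longrightarrow> zero_one_polytope p (P i)"
    and "\<And>i j. i \<in> {1..k} \<Longrightarrow> j \<in> {1..k} \<Longrightarrow> i \<noteq> j \<Longrightarrow> P i \<inter> P j = {}"
  shows "xc_star p (convex hull (\<Union>i\<in>{1..k}. P i))
           \<le> (\<Sum>i=1..k. xc_star p (P i)) + card {i \<in> {1..k}. affine_dim (P i) = 0}"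
proof -
  \<comment> \<open>The hull of some of the polytopes may meet the next one; only the vertex sets stay disjoint.\<close>
  have "zero_one_polytope p (convex hull (\<Union>i\<in>I. P i)) \<and>
      (\<forall>v. v extreme_point_of (convex hull (\<Union>i\<in>I. P i)) \<longrightarrow> v \<in> (\<Union>i\<in>I. P i)) \<and>
      weight p (convex hull (\<Union>i\<in>I. P i)) \<le> (\<Sum>i\<in>I. weight p (P i))"
    if "finite I" "I \<subseteq> {1..k}" for I
    using that
  proof (induction I)
    case empty
    \<comment> \<open>The empty hull has weight 0: it has dimension -1 rather than 0, and its
      \<open>xc_star\<close> is 0.\<close>
    then show ?case
      by (simp add: zero_one_polytope_empty weight_def xc_star_empty affine_dim_empty
          extreme_point_of_def)
  next
    case (insert i I)
    let ?H = "convex hull (\<Union>i\<in>I. P i)"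
    have H: "zero_one_polytope p ?H" "weight p ?H \<le> (\<Sum>i\<in>I. weight p (P i))"
      and extH: "\<And>v. v extreme_point_of ?H \<Longrightarrow> v \<in> (\<Union>i\<in>I. P i)"
      using insert by auto
    have Pi: "zero_one_polytope p (P i)" using insert assms(1) by auto
    have disj: "\<not> (v extreme_point_of P i \<and> v extreme_point_of ?H)" for v
    proof
      assume v: "v extreme_point_of P i \<and> v extreme_point_of ?H"
      then obtain j where "j \<in> I" "v \<in> P j" using extH by blast
      moreover have "v \<in> P i" using v by (simp add: extreme_point_of_def)
      ultimately show False
        using assms(2)[of i j] insert.hyps(2) insert.prems by blast
    qed
    have eq: "convex hull (\<Union>i\<in>insert i I. P i) = convex hull (P i \<union> ?H)"
      using hull_Un_right[of convex "P i" "\<Union>i\<in>I. P i"] by simp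
    have "weight p (convex hull (P i \<union> ?H)) \<le> weight p (P i) + weight p ?H"
      using weight_convex_hull_Un[OF Pi H(1) disj] .
    then have "weight p (convex hull (P i \<union> ?H)) \<le> (\<Sum>i\<in>insert i I. weight p (P i))"
      using H(2) insert.hyps by simp
    moreover have "\<forall>v. v extreme_point_of (convex hull (\<Union>i\<in>insert i I. P i)) \<longrightarrow> v \<in> (\<Union>i\<in>insert i I. P i)"
      using extreme_point_of_convex_hull by blast
    ultimately show ?case
      using zero_one_polytope_convex_hull_Un[OF Pi H(1)] unfolding eq by blast
  qed
  from this[of "{1..k}"] have "weight p (convex hull (\<Union>i\<in>{1..k}. P i)) \<le> (\<Sum>i=1..k. weight p (P i))"
    by simp
  \<comment> \<open>Summing the indicators of dimension 0 counts the points among the given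
    polytopes.\<close>
  also have "\<dots> = (\<Sum>i=1..k. xc_star p (P i)) + card {i \<in> {1..k}. affine_dim (P i) = 0}"
    by (simp add: weight_def sum.distrib of_bool_def sum.If_cases Int_def)
  finally show ?thesis by (simp add: weight_def)
qed

end
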